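(* Suppose $u$ and $m$ satisfy $m_t+u\,m_\theta+\lambda u_\theta m=0$ on $S^1$ with momentum defined by $m=Hu_\theta$, where $H$ is the Hilbert transform (the modified Constantin-Lax-Majda equation). Let $\eta$ be the flow of $u$ and $m_0=m(0,\cdot)$. Define the transformation $$x=\eta_\theta^{\lambda/2}\cos\psi,\qquad y=\eta_\theta^{\lambda/2}\sin\psi,$$ where $\psi$ is defined by $$\psi(t,\theta)=\frac{\lambda m_0(\theta)}{2}\int_0^t\frac{d\tau}{\eta_\theta(\tau,\theta)^\lambda}.$$ Then $(x,y)$ satisfy a solar model (a central-force system) of the form $$x_{tt}(t,\theta)=-\frac{\lambda}{2}F\big(t,\eta(t,\theta)\big)\,x(t,\theta),\qquad y_{tt}(t,\theta)=-\frac{\lambda}{2}F\big(t,\eta(t,\theta)\big)\,y(t,\theta),$$ where $F(t,\theta)$ is always positive.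
   Context: $S^1=\mathbb{R}/\mathbb{Z}$ and $\lambda$ is a real parameter. $H$ is the periodic Hilbert transform, $H(e^{2\pi i n\theta})=-i\,\mathrm{sgn}(n)\,e^{2\pi i n\theta}$ (with $H1=0$). The flow $\eta$ is defined by $\eta_t(t,\theta)=u(t,\eta(t,\theta))$, $\eta(0,\theta)=\theta$.
   Formalization: Strict positivity of F is claimed only when u(0,·) is not constant; for constant u (where m = 0, x = 1, y = 0 and, for λ ≠ 0, F = 0 is forced) only F ≥ 0 is claimed. *)

theory Defs
  imports "HOL-Analysis.Analysis"
begin

text \<open>Functions on the circle \<open>\<real>/\<int>\<close> are 1-periodic functions on the reals, and circle maps are
  given by lifts. A function of time and space is written \<open>f t \<theta>\<close>.\<close>

definition periodic1 :: "(real \<Rightarrow> 'a) \<Rightarrow> bool" where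
  "periodic1 f \<longleftrightarrow> (\<forall>\<theta>. f (\<theta> + 1) = f \<theta>)"

text \<open>The half-open interval \<open>[0,T)\<close>, where \<open>T = \<infinity>\<close> is allowed.\<close>

definition time_interval :: "ereal \<Rightarrow> real set" where
  "time_interval T = {t. 0 \<le> t \<and> ereal t < T}"

text \<open>Infinite differentiability on \<open>J \<times> \<real>\<close>, where \<open>D j k\<close> is \<open>\<partial>\<^sub>t\<^sup>j \<partial>\<^sub>\<theta>\<^sup>k f\<close>; the time
  derivatives are taken within \<open>J\<close>, hence are one-sided at an end point of \<open>J\<close>.\<close>

definition smooth_time_space :: "real set \<Rightarrow> (real \<Rightarrow> real \<Rightarrow> real) \<Rightarrow> bool" where
  "smooth_time_space J f \<longleftrightarrow>
    (\<exists>D :: nat \<Rightarrow> nat \<Rightarrow> real \<Rightarrow> real \<Rightarrow> real.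
       (\<forall>t\<in>J. \<forall>\<theta>. D 0 0 t \<theta> = f t \<theta>) \<and>
       (\<forall>j k. continuous_on (J \<times> UNIV) (\<lambda>(t, \<theta>). D j k t \<theta>)) \<and>
       (\<forall>j k. \<forall>t\<in>J. \<forall>\<theta>.
          ((\<lambda>s. D j k s \<theta>) has_real_derivative D (Suc j) k t \<theta>) (at t within J) \<and>
          (D j k t has_real_derivative D j (Suc k) t \<theta>) (at \<theta>)))"

definition fourier_coeff :: "(real \<Rightarrow> real) \<Rightarrow> int \<Rightarrow> complex" where
  "fourier_coeff f n =
     integral {0..1} (\<lambda>\<theta>. complex_of_real (f \<theta>) * cis (- 2 * pi * real_of_int n * \<theta>))"

text \<open>The periodic Hilbert transform, i.e. the Fourier multiplier \<open>-\<i> sgn n\<close>. For a smooth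
  periodic function, the only case in which it is used, the series converges absolutely; its sum
  is real because the function is real-valued, so that taking the real part only changes the
  type.\<close>

definition hilbert :: "(real \<Rightarrow> real) \<Rightarrow> real \<Rightarrow> real" where
  "hilbert f \<theta> =
     Re (\<Sum>\<^sub>\<infinity>n\<in>(UNIV :: int set).
           - \<i> * of_int (sgn n) * fourier_coeff f n * cis (2 * pi * real_of_int n * \<theta>))"

text \<open>Smooth solutions on \<open>J\<close> of \<open>m\<^sub>t + u m\<^sub>\<theta> + \<lambda> u\<^sub>\<theta> m = 0\<close> with \<open>m = H u\<^sub>\<theta>\<close>; here \<open>lam\<close> is \<open>\<lambda>\<close>.\<close>

definition mCLM_solution ::
  "real \<Rightarrow> real set \<Rightarrow> (real \<Rightarrow> real \<Rightarrow> real) \<Rightarrow> (real \<Rightarrow> real \<Rightarrow> real) \<Rightarrow> bool" where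
  "mCLM_solution lam J u m \<longleftrightarrow>
     smooth_time_space J u \<and>
     (\<forall>t\<in>J. periodic1 (u t)) \<and>
     (\<forall>t\<in>J. \<forall>\<theta>. m t \<theta> = hilbert (deriv (u t)) \<theta>) \<and>
     (\<forall>t\<in>J. \<forall>\<theta>. \<exists>m\<^sub>t m\<^sub>\<theta>.
        ((\<lambda>s. m s \<theta>) has_real_derivative m\<^sub>t) (at t within J) \<and>
        (m t has_real_derivative m\<^sub>\<theta>) (at \<theta>) \<and>
        m\<^sub>t + u t \<theta> * m\<^sub>\<theta> + lam * deriv (u t) \<theta> * m t \<theta> = 0)"

text \<open>The flow of \<open>u\<close>, lifted to the real line.\<close>

definition is_flow ::
  "real set \<Rightarrow> (real \<Rightarrow> real \<Rightarrow> real) \<Rightarrow> (real \<Rightarrow> real \<Rightarrow> real) \<Rightarrow> bool" where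
  "is_flow J u \<eta> \<longleftrightarrow>
     (\<forall>\<theta>. \<eta> 0 \<theta> = \<theta>) \<and>
     (\<forall>t\<in>J. \<forall>\<theta>. ((\<lambda>s. \<eta> s \<theta>) has_real_derivative u t (\<eta> t \<theta>)) (at t within J))"

definition has_second_derivative_within ::
  "(real \<Rightarrow> real) \<Rightarrow> real \<Rightarrow> real \<Rightarrow> real set \<Rightarrow> bool" where
  "has_second_derivative_within f c t J \<longleftrightarrow>
     (\<exists>f'. (\<forall>s\<in>J. (f has_real_derivative f' s) (at s within J)) \<and>
           (f' has_real_derivative c) (at t within J))"

text \<open>The angle \<open>\<psi>\<close> and the Cartesian coordinates \<open>x, y\<close>. Here \<open>deriv (\<eta> t) \<theta>\<close> is \<open>\<eta>\<^sub>\<theta>(t,\<theta>)\<close>,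
  which exists and is positive for the flow of a smooth field.\<close>

definition solar_angle ::
  "real \<Rightarrow> (real \<Rightarrow> real \<Rightarrow> real) \<Rightarrow> (real \<Rightarrow> real \<Rightarrow> real) \<Rightarrow> real \<Rightarrow> real \<Rightarrow> real" where
  "solar_angle lam m \<eta> t \<theta> =
     lam * m 0 \<theta> / 2 * integral {0..t} (\<lambda>\<tau>. 1 / deriv (\<eta> \<tau>) \<theta> powr lam)"

definition solar_x ::
  "real \<Rightarrow> (real \<Rightarrow> real \<Rightarrow> real) \<Rightarrow> (real \<Rightarrow> real \<Rightarrow> real) \<Rightarrow> real \<Rightarrow> real \<Rightarrow> real" where
  "solar_x lam m \<eta> t \<theta> = deriv (\<eta> t) \<theta> powr (lam / 2) * cos (solar_angle lam m \<eta> t \<theta>)"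

definition solar_y ::
  "real \<Rightarrow> (real \<Rightarrow> real \<Rightarrow> real) \<Rightarrow> (real \<Rightarrow> real \<Rightarrow> real) \<Rightarrow> real \<Rightarrow> real \<Rightarrow> real" where
  "solar_y lam m \<eta> t \<theta> = deriv (\<eta> t) \<theta> powr (lam / 2) * sin (solar_angle lam m \<eta> t \<theta>)"

end

theory Submission imports Defs begin

text \<open>
  Put \<open>r = \<eta>\<^sub>\<theta> powr (lam / 2)\<close> and follow a trajectory. The equation says that \<open>m(t, \<eta>) \<eta>\<^sub>\<theta> powr lam\<close> is
  conserved, so that the angle satisfies \<open>\<psi>\<^sub>t = (lam / 2) m(t, \<eta>)\<close> and \<open>r\<^sup>2 \<psi>\<^sub>t\<close> is constant: in
  polar coordinates \<open>(r, \<psi>)\<close> angular momentum is conserved, and the acceleration is radial. Since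
  \<open>r\<^sub>t = (lam / 2) u\<^sub>\<theta>(t, \<eta>) r\<close>, two differentiations give the force
  \<open>F = - (u\<^sub>t\<^sub>\<theta> + u u\<^sub>\<theta>\<^sub>\<theta> + (lam / 2) (u\<^sub>\<theta>\<^sup>2 - m\<^sup>2))\<close>
  (\<open>momentum_transport\<close>, \<open>solar_acceleration\<close>).

  For the sign of \<open>F\<close>, time is fixed. For a real function \<open>f\<close> the function \<open>f + \<i> H f\<close> has
  nonnegative frequencies only. Consider
  \<open>G = (u\<^sub>t\<^sub>\<theta> + \<i> H u\<^sub>t\<^sub>\<theta>) + u (u\<^sub>\<theta>\<^sub>\<theta> + \<i> H u\<^sub>\<theta>\<^sub>\<theta>) + (lam / 2) (u\<^sub>\<theta> + \<i> H u\<^sub>\<theta>)\<^sup>2\<close>.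
  Its real part is \<open>- F\<close>, and its imaginary part is the left hand side of the equation, hence 0.
  Write \<open>u = a + p + cnj p\<close> with \<open>a\<close> the mean and \<open>p\<close> the sum over the positive frequencies. Then
  \<open>u\<^sub>\<theta>\<^sub>\<theta> + \<i> H u\<^sub>\<theta>\<^sub>\<theta> = 2 p''\<close>, and all terms of \<open>G\<close> have positive frequencies only, except
  \<open>2 (cnj p) p''\<close>. Let \<open>\<phi>\<^sub>l\<close> be the part of \<open>p\<close> with frequencies at least \<open>l\<close>. As \<open>l\<^sup>2\<close> is the sum of
  the first \<open>l\<close> odd numbers, \<open>p'' = - 4 pi\<^sup>2 (\<Sum>l\<ge>1. (2 l - 1) \<phi>\<^sub>l)\<close>. Therefore, with
  \<open>Q = 8 pi\<^sup>2 (\<Sum>l\<ge>1. (2 l - 1) \<bar>\<phi>\<^sub>l\<bar>\<^sup>2)\<close>,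
  \<open>2 (cnj p) p'' + Q = 8 pi\<^sup>2 (\<Sum>l\<ge>1. (2 l - 1) \<phi>\<^sub>l cnj (\<phi>\<^sub>l - p))\<close>,
  and here \<open>\<phi>\<^sub>l\<close> has frequencies at least \<open>l\<close> while those of \<open>cnj (\<phi>\<^sub>l - p)\<close> are larger than
  \<open>- l\<close>. So \<open>G + Q\<close> has positive frequencies only; being real it is 0, that is, \<open>F = Q\<close>
  (\<open>real_hardy_eq_0\<close>, \<open>hardy_energy\<close>, \<open>force_eq_energy\<close>).

  A sum of squares is nonnegative. If it vanishes at one point, then all \<open>\<phi>\<^sub>l\<close> vanish there, hence so
  do their differences, so \<open>u\<close> is constant at that time and its momentum is 0. By the conservation
  law the initial momentum is 0 as well, and then \<open>u\<close> was constant initially (\<open>force_pos\<close>,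
  \<open>force_zero_imp_constant\<close>).

  The analytic input is the inversion of Fourier series of smooth functions, by way of
  Stone--Weierstrass (\<open>fourier_uniqueness\<close>, \<open>fourier_inversion\<close>), the fact that \<open>H\<close> commutes with
  derivatives in space and time (\<open>hilbert_has_derivative\<close>, \<open>hilbert_time_derivative\<close>), and the
  differentiability of the flow in space (\<open>flow_has_jacobian\<close>).
\<close>

section \<open>Fourier coefficients\<close>

definition echar :: "int \<Rightarrow> real \<Rightarrow> complex" where
  "echar n \<theta> = cis (2 * pi * real_of_int n * \<theta>)"

text \<open>The same integral as in \<open>fourier_coeff\<close>, but for complex-valued functions: the proof
  multiplies by characters and by holomorphic boundary values, which leaves the real functions.\<close>

definition ccoeff :: "(real \<Rightarrow> complex) \<Rightarrow> int \<Rightarrow> complex" where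
  "ccoeff g n = integral {0..1} (\<lambda>\<theta>. g \<theta> * echar (- n) \<theta>)"

lemma fourier_coeff_eq_ccoeff: "fourier_coeff f n = ccoeff (\<lambda>\<theta>. complex_of_real (f \<theta>)) n"
  by (simp add: fourier_coeff_def ccoeff_def echar_def)

lemma norm_echar [simp]: "norm (echar n \<theta>) = 1"
  by (simp add: echar_def)

lemma echar_mult: "echar m \<theta> * echar n \<theta> = echar (m + n) \<theta>"
  by (simp add: echar_def cis_mult algebra_simps)

lemma echar_0 [simp]: "echar 0 \<theta> = 1"
  by (simp add: echar_def)

lemma cnj_echar [simp]: "cnj (echar n \<theta>) = echar (- n) \<theta>"
  by (simp add: echar_def cis_cnj)

lemma continuous_on_echar [continuous_intros]: "continuous_on A (echar n)"
  unfolding echar_def by (intro continuous_intros)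

lemma echar_at_1 [simp]: "echar n 1 = 1"
proof -
  have "echar n 1 = cis (2 * pi * real_of_int n)" by (simp add: echar_def)
  also have "\<dots> = 1" by (rule cis_multiple_2pi) simp
  finally show ?thesis .
qed

lemma has_vector_derivative_echar:
  "(echar n has_vector_derivative (2 * pi * \<i> * of_int n * echar n \<theta>)) (at \<theta> within S)"
proof -
  have "((\<lambda>\<theta>. cis (2 * pi * real_of_int n * \<theta>)) has_vector_derivative
          (2 * pi * real_of_int n) *\<^sub>R (\<i> * cis (2 * pi * real_of_int n * \<theta>))) (at \<theta> within S)"
    unfolding has_vector_derivative_def
    by (auto intro!: derivative_eq_intros simp: scaleR_conv_of_real)
  then show ?thesis unfolding echar_def [abs_def]
    by (simp add: scaleR_conv_of_real mult_ac)
qed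

lemma ccoeff_integrable:
  assumes "continuous_on UNIV g"
  shows "(\<lambda>\<theta>. g \<theta> * echar n \<theta>) integrable_on {0..1}"
  by (intro integrable_continuous_real continuous_intros continuous_on_subset[OF assms]) auto

lemma ccoeff_add:
  assumes "continuous_on UNIV f" "continuous_on UNIV g"
  shows "ccoeff (\<lambda>\<theta>. f \<theta> + g \<theta>) n = ccoeff f n + ccoeff g n"
  unfolding ccoeff_def distrib_right
  by (intro integral_add ccoeff_integrable assms)

lemma ccoeff_cmult: "ccoeff (\<lambda>\<theta>. c * f \<theta>) n = c * ccoeff f n"
  unfolding ccoeff_def mult.assoc by (rule integral_mult_right)

lemma ccoeff_echar_mult: "ccoeff (\<lambda>\<theta>. echar k \<theta> * f \<theta>) n = ccoeff f (n - k)"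
proof -
  have "echar k \<theta> * f \<theta> * echar (- n) \<theta> = f \<theta> * echar (- (n - k)) \<theta>" for \<theta>
    using echar_mult[of k \<theta> "-n"] by (simp add: mult_ac)
  then show ?thesis unfolding ccoeff_def by presburger
qed

lemma cnj_ccoeff: "cnj (ccoeff g n) = ccoeff (\<lambda>\<theta>. cnj (g \<theta>)) (- n)"
  unfolding ccoeff_def by (simp add: integral_cnj)

lemma norm_ccoeff_le:
  assumes "continuous_on UNIV g" "\<And>\<theta>. \<theta> \<in> {0..1} \<Longrightarrow> norm (g \<theta>) \<le> C"
  shows "norm (ccoeff g n) \<le> C"
proof -
  have "norm (integral (cbox 0 1) (\<lambda>\<theta>. g \<theta> * echar (- n) \<theta>)) \<le> C * measure lborel (cbox 0 (1::real))"
    using ccoeff_integrable[OF assms(1), of "-n"] assms(2) order_trans[OF norm_ge_zero assms(2)[of 0]]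
    by (intro integrable_bound) (auto simp: norm_mult)
  then show ?thesis by (simp add: ccoeff_def)
qed

section \<open>Uniqueness of Fourier coefficients\<close>

lemma continuous_on_polynomial_echar:
  assumes "real_polynomial_function q"
  shows "continuous_on A (\<lambda>\<theta>. q (echar 1 \<theta>))"
proof -
  have "continuous_on UNIV q"
    using assms continuous_on_polymonial_function real_polynomial_function_eq by blast
  then show ?thesis
    by (rule continuous_on_compose2) (auto intro: continuous_intros)
qed

text \<open>The functions with vanishing Fourier coefficients form an ideal. The induction has to run
  over an arbitrary member \<open>h\<close> of the ideal, so that products of polynomials can be absorbed one
  factor at a time; a linear polynomial is a combination of \<open>z\<close> and \<open>cnj z\<close> and only shifts
  coefficients.\<close>

lemma ccoeff_times_polynomial_eq_0:
  assumes "real_polynomial_function q" and "continuous_on UNIV h" and "\<And>n. ccoeff h n = 0"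
  shows "ccoeff (\<lambda>\<theta>. complex_of_real (q (echar 1 \<theta>)) * h \<theta>) n = 0"
  using assms
proof (induction q arbitrary: h n rule: real_polynomial_function.induct)
  case (linear q)
  interpret q: bounded_linear q by fact
  \<comment> \<open>The coefficients for which the real-linear \<open>q\<close> is \<open>a z + b cnj z\<close>.\<close>
  define a where "a = (q 1 - \<i> * q \<i>) / 2"
  define b where "b = (q 1 + \<i> * q \<i>) / 2"
  have "complex_of_real (q z) = a * z + b * cnj z" for z
  proof -
    have "q z = q (Re z *\<^sub>R 1 + Im z *\<^sub>R \<i>)"
      by (rule arg_cong[where f = q]) (simp add: complex_eq_iff)
    also have "\<dots> = Re z * q 1 + Im z * q \<i>"
      unfolding q.add q.scaleR by simp
    finally show ?thesis
      by (simp add: a_def b_def complex_eq_iff field_simps)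
  qed
  then have *: "(\<lambda>\<theta>. complex_of_real (q (echar 1 \<theta>)) * h \<theta>) =
      (\<lambda>\<theta>. a * (echar 1 \<theta> * h \<theta>) + b * (echar (-1) \<theta> * h \<theta>))"
    by (simp add: algebra_simps)
  show ?case unfolding * using linear
    by (subst ccoeff_add) (auto intro!: continuous_intros simp: ccoeff_cmult ccoeff_echar_mult)
next
  case (const c)
  then show ?case by (simp add: ccoeff_cmult)
next
  case (add p q)
  have "ccoeff (\<lambda>\<theta>. complex_of_real (p (echar 1 \<theta>)) * h \<theta> + complex_of_real (q (echar 1 \<theta>)) * h \<theta>) n
      = ccoeff (\<lambda>\<theta>. complex_of_real (p (echar 1 \<theta>)) * h \<theta>) n
        + ccoeff (\<lambda>\<theta>. complex_of_real (q (echar 1 \<theta>)) * h \<theta>) n"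
    using add.prems(1) add.hyps by (intro ccoeff_add continuous_intros continuous_on_polynomial_echar)
  then show ?case unfolding of_real_add distrib_right
    using add.IH[OF add.prems] by simp
next
  case (mult p q)
  have "continuous_on UNIV (\<lambda>\<theta>. complex_of_real (q (echar 1 \<theta>)) * h \<theta>)"
    using mult.prems(1) mult.hyps by (intro continuous_intros continuous_on_polynomial_echar)
  then show ?case unfolding of_real_mult mult.assoc
    using mult.IH(2)[OF mult.prems] by (rule mult.IH(1))
qed

lemma periodic1_add_int:
  assumes "periodic1 f"
  shows "f (\<theta> + real_of_int k) = f \<theta>"
proof -
  have *: "f (\<theta> + real n) = f \<theta>" for n \<theta>
    using assms by (induction n) (auto simp: periodic1_def add.assoc [symmetric] add.commute[of 1])
  show ?thesis
  proof (cases "k \<ge> 0")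
    case True
    then show ?thesis using *[of \<theta> "nat k"] by simp
  next
    case False
    then show ?thesis using *[of "\<theta> + real_of_int k" "nat (- k)"] by simp
  qed
qed

lemma periodic1_unit_interval:
  assumes "periodic1 f"
  obtains \<theta>' where "\<theta>' \<in> {0..1}" "f \<theta> = f \<theta>'"
proof
  show "frac \<theta> \<in> {0..1}" using frac_lt_1[of \<theta>] by (simp add: less_imp_le)
  show "f \<theta> = f (frac \<theta>)"
    using periodic1_add_int[OF assms, of "frac \<theta>" "\<lfloor>\<theta>\<rfloor>"] by (simp add: frac_def)
qed

text \<open>A continuous function on the circle \<open>\<real>/\<int>\<close> is a continuous function on the unit circle
  of the complex plane: the argument is continuous off a ray, and two branches with opposite rays
  agree up to a period.\<close>

lemma periodic_factors_through_circle:
  fixes f :: "real \<Rightarrow> real"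
  assumes cont: "continuous_on UNIV f" and per: "periodic1 f"
  obtains g :: "complex \<Rightarrow> real" where "continuous_on (sphere 0 1) g" "\<And>\<theta>. g (echar 1 \<theta>) = f \<theta>"
proof
  define g where "g = (\<lambda>z. f (Arg z / (2 * pi)))"
  have eq: "f a = f b" if ab: "cis (2 * pi * a) = cis (2 * pi * b)" for a b
  proof -
    obtain k :: int where "2 * pi * a = 2 * pi * b + 2 * pi * of_int k"
      using ab sin_cos_eq_iff[of "2 * pi * a" "2 * pi * b"] by (auto simp: cis.ctr)
    then have "2 * pi * a = 2 * pi * (b + of_int k)" by (simp add: algebra_simps)
    then have "a = b + of_int k" by simp
    then show ?thesis using periodic1_add_int[OF per] by simp
  qed
  show "g (echar 1 \<theta>) = f \<theta>" for \<theta>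
  proof -
    have "cis (2 * pi * (Arg (echar 1 \<theta>) / (2 * pi))) = echar 1 \<theta>"
      using cis_Arg[of "echar 1 \<theta>"] by (simp add: sgn_div_norm) (metis norm_echar norm_zero zero_neq_one)
    then show ?thesis unfolding g_def by (intro eq) (simp add: echar_def)
  qed
  have g2: "g z = f (Arg2pi z / (2 * pi))" if "norm z = 1" for z
  proof -
    have "z \<noteq> 0" using that by auto
    then have "cis (Arg z) = z" "cis (Arg2pi z) = z"
      using cis_Arg[of z] Arg2pi_eq[of z] that by (simp_all add: sgn_div_norm cis_conv_exp)
    then show ?thesis unfolding g_def by (intro eq) simp
  qed
  have fc: "isCont f a" for a using cont by (simp add: continuous_on_eq_continuous_at)
  show "continuous_on (sphere 0 1) g"
    unfolding continuous_on_eq_continuous_within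
  proof
    fix z :: complex assume z: "z \<in> sphere 0 1"
    show "continuous (at z within sphere 0 1) g"
    proof (cases "z \<in> \<real>\<^sub>\<le>\<^sub>0")
      case False
      then have "isCont (\<lambda>z. Arg z / (2 * pi)) z"
        by (intro continuous_intros) (auto intro: continuous_at_Arg)
      then have "isCont g z" unfolding g_def
        by (rule isCont_o2) (rule fc)
      then show ?thesis by (rule continuous_at_imp_continuous_within)
    next
      case True
      then have "z \<notin> \<real>\<^sub>\<ge>\<^sub>0" using z
        by (auto simp: complex_nonpos_Reals_iff complex_nonneg_Reals_iff cmod_def)
      then have "isCont (\<lambda>z. Arg2pi z / (2 * pi)) z"
        by (intro continuous_intros) (auto intro: continuous_at_Arg2pi)
      then have "isCont (\<lambda>z. f (Arg2pi z / (2 * pi))) z"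
        by (rule isCont_o2) (rule fc)
      then have "continuous (at z within sphere 0 1) (\<lambda>z. f (Arg2pi z / (2 * pi)))"
        by (rule continuous_at_imp_continuous_within)
      then show ?thesis
        using z by (rule continuous_transform_within[OF _ zero_less_one]) (auto simp: g2)
    qed
  qed
qed

text \<open>By the previous lemma \<open>f\<close> is orthogonal to all polynomials in \<open>cos\<close> and \<open>sin\<close>. By the
  Stone--Weierstrass theorem on the unit circle these come arbitrarily close to \<open>f\<close>, so \<open>f\<close> is
  orthogonal to itself.\<close>

lemma fourier_uniqueness:
  fixes f :: "real \<Rightarrow> real"
  assumes cont: "continuous_on UNIV f" and per: "periodic1 f"
    and zero: "\<And>n. fourier_coeff f n = 0"
  shows "f \<theta> = 0"
proof -
  obtain g :: "complex \<Rightarrow> real" where g: "continuous_on (sphere 0 1) g" "\<And>\<theta>. g (echar 1 \<theta>) = f \<theta>"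
    using periodic_factors_through_circle[OF cont per] by blast
  have cont1: "continuous_on {0..1} f" using cont continuous_on_subset by blast
  have int2: "(\<lambda>\<theta>. (f \<theta>)\<^sup>2) integrable_on {0..1}" and int1: "(\<lambda>\<theta>. \<bar>f \<theta>\<bar>) integrable_on {0..1}"
    by (intro integrable_continuous_real continuous_intros cont1)+
  define A where "A = integral {0..1} (\<lambda>\<theta>. \<bar>f \<theta>\<bar>)"
  have small: "integral {0..1} (\<lambda>\<theta>. (f \<theta>)\<^sup>2) \<le> e * A" if e: "e > 0" for e
  proof -
    obtain q where q: "real_polynomial_function q" "\<And>z. z \<in> sphere 0 1 \<Longrightarrow> \<bar>g z - q z\<bar> < e"
      using Stone_Weierstrass_real_polynomial_function[OF compact_sphere g(1) e] by blast
    note qc = continuous_on_polynomial_echar[OF q(1)]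
    have "ccoeff (\<lambda>\<theta>. complex_of_real (q (echar 1 \<theta>)) * complex_of_real (f \<theta>)) 0 = 0"
      using zero cont by (intro ccoeff_times_polynomial_eq_0[OF q(1)] continuous_intros)
        (auto simp: fourier_coeff_eq_ccoeff)
    then have "integral {0..1} (\<lambda>\<theta>. complex_of_real (q (echar 1 \<theta>) * f \<theta>)) = 0"
      by (simp add: ccoeff_def)
    moreover have iq: "(\<lambda>\<theta>. q (echar 1 \<theta>) * f \<theta>) integrable_on {0..1}"
      by (intro integrable_continuous_real continuous_intros cont1 continuous_on_subset[OF qc]) auto
    ultimately have orth: "integral {0..1} (\<lambda>\<theta>. q (echar 1 \<theta>) * f \<theta>) = 0"
      using integral_linear[OF iq bounded_linear_of_real[where 'a = complex]] by (simp add: o_def)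
    have "integral {0..1} (\<lambda>\<theta>. (f \<theta>)\<^sup>2)
        = integral {0..1} (\<lambda>\<theta>. (f \<theta>)\<^sup>2) - integral {0..1} (\<lambda>\<theta>. q (echar 1 \<theta>) * f \<theta>)"
      using orth by simp
    also have "\<dots> = integral {0..1} (\<lambda>\<theta>. (f \<theta>)\<^sup>2 - q (echar 1 \<theta>) * f \<theta>)"
      by (rule integral_diff[symmetric]) (fact int2 iq)+
    also have "\<dots> \<le> integral {0..1} (\<lambda>\<theta>. e * \<bar>f \<theta>\<bar>)"
    proof (rule integral_le)
      show "(\<lambda>\<theta>. (f \<theta>)\<^sup>2 - q (echar 1 \<theta>) * f \<theta>) integrable_on {0..1}"
        by (intro integrable_diff int2 iq)
      show "(\<lambda>\<theta>. e * \<bar>f \<theta>\<bar>) integrable_on {0..1}"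
        using integrable_on_mult_right[OF int1] by simp
      fix \<theta>
      have "(f \<theta>)\<^sup>2 - q (echar 1 \<theta>) * f \<theta> = (g (echar 1 \<theta>) - q (echar 1 \<theta>)) * f \<theta>"
        by (simp add: g power2_eq_square algebra_simps)
      also have "\<dots> \<le> \<bar>g (echar 1 \<theta>) - q (echar 1 \<theta>)\<bar> * \<bar>f \<theta>\<bar>"
        by (metis abs_ge_self abs_mult)
      also have "\<dots> \<le> e * \<bar>f \<theta>\<bar>"
        using q(2)[of "echar 1 \<theta>"] by (intro mult_right_mono) (auto simp: less_imp_le)
      finally show "(f \<theta>)\<^sup>2 - q (echar 1 \<theta>) * f \<theta> \<le> e * \<bar>f \<theta>\<bar>" .
    qed
    also have "\<dots> = e * A" by (simp add: A_def)
    finally show ?thesis .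
  qed
  have "integral {0..1} (\<lambda>\<theta>. (f \<theta>)\<^sup>2) \<le> 0"
  proof (rule field_le_epsilon)
    fix e :: real assume "e > 0"
    have "A \<ge> 0" unfolding A_def by (intro integral_nonneg int1) simp
    then have "e / (A + 1) * A \<le> e" using \<open>e > 0\<close> by (simp add: field_simps)
    then show "integral {0..1} (\<lambda>\<theta>. (f \<theta>)\<^sup>2) \<le> 0 + e"
      using small[of "e / (A + 1)"] \<open>e > 0\<close> \<open>A \<ge> 0\<close> by simp
  qed
  then have "integral {0..1} (\<lambda>\<theta>. (f \<theta>)\<^sup>2) = 0"
    using integral_nonneg[OF int2] by simp
  then have "((\<lambda>\<theta>. (f \<theta>)\<^sup>2) has_integral 0) (cbox 0 1)"
    using int2 by (simp add: has_integral_iff)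
  then have "(f x)\<^sup>2 = 0" if "x \<in> {0..1}" for x
    using has_integral_0_cbox_imp_0[of 0 "1::real" "\<lambda>\<theta>. (f \<theta>)\<^sup>2" x] that cont1
    by (auto intro!: continuous_intros simp: box_ne_empty)
  then show ?thesis
    using periodic1_unit_interval[OF per, of \<theta>] by (metis power_eq_0_iff)
qed

section \<open>Coefficients of uniformly convergent series\<close>

lemma ccoeff_1: "ccoeff (\<lambda>\<theta>. 1) n = (if n = 0 then 1 else 0)"
proof (cases "n = 0")
  case False
  define c where "c = inverse (2 * pi * \<i> * of_int (- n))"
  have "((\<lambda>\<theta>. c * echar (- n) \<theta>) has_vector_derivative echar (- n) \<theta>) (at \<theta> within {0..1})" for \<theta>
    by (rule has_vector_derivative_eq_rhs,
        rule has_vector_derivative_mult_right[OF has_vector_derivative_echar])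
       (use False in \<open>simp add: c_def field_simps\<close>)
  then have "(echar (- n) has_integral (c * echar (- n) 1 - c * echar (- n) 0)) {0..1}"
    by (intro fundamental_theorem_of_calculus) auto
  moreover have "echar (- n) 0 = 1" by (simp add: echar_def)
  ultimately have "(echar (- n) has_integral 0) {0..1}" by simp
  then have "integral {0..1} (echar (- n)) = 0" by (rule integral_unique)
  then show ?thesis using False by (simp add: ccoeff_def)
qed (simp add: ccoeff_def)

lemma ccoeff_echar: "ccoeff (echar k) n = (if n = k then 1 else 0)"
  using ccoeff_echar_mult[of k "\<lambda>\<theta>. 1" n] by (simp add: ccoeff_1)

lemma ccoeff_suminf:
  assumes cont: "\<And>n. continuous_on UNIV (f n)" and M: "\<And>n \<theta>. norm (f n \<theta>) \<le> M n" "summable M"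
  shows "continuous_on UNIV (\<lambda>\<theta>. \<Sum>n. f n \<theta>)"
    and "(\<lambda>n. ccoeff (f n) k) sums ccoeff (\<lambda>\<theta>. \<Sum>n. f n \<theta>) k"
proof -
  have "uniform_limit UNIV (\<lambda>n \<theta>. \<Sum>i<n. f i \<theta>) (\<lambda>\<theta>. \<Sum>n. f n \<theta>) sequentially"
    using M by (intro Weierstrass_m_test)
  then show "continuous_on UNIV (\<lambda>\<theta>. \<Sum>n. f n \<theta>)"
    by (rule uniform_limit_theorem[rotated]) (auto intro!: always_eventually continuous_on_sum cont)
next
  have lim: "uniform_limit {0..1} (\<lambda>n \<theta>. \<Sum>i<n. f i \<theta> * echar (- k) \<theta>)
               (\<lambda>\<theta>. \<Sum>n. f n \<theta> * echar (- k) \<theta>) sequentially"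
    using M by (intro Weierstrass_m_test) (auto simp: norm_mult)
  have "continuous_on {0..1} (\<lambda>\<theta>. \<Sum>i<n. f i \<theta> * echar (- k) \<theta>)" for n
    using cont by (intro continuous_intros) (meson continuous_on_subset subset_UNIV)
  from uniform_limit_integral[OF lim this] obtain I L where
    I: "\<And>n. ((\<lambda>\<theta>. \<Sum>i<n. f i \<theta> * echar (- k) \<theta>) has_integral I n) {0..1}"
    and L: "((\<lambda>\<theta>. \<Sum>n. f n \<theta> * echar (- k) \<theta>) has_integral L) {0..1}" and "I \<longlonglongrightarrow> L"
    by auto
  have "I = (\<lambda>n. \<Sum>i<n. ccoeff (f i) k)"
  proof
    fix n show "I n = (\<Sum>i<n. ccoeff (f i) k)"
      unfolding ccoeff_def integral_unique[OF I[of n], symmetric]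
      by (rule integral_sum) (auto intro!: ccoeff_integrable cont)
  qed
  moreover have "L = ccoeff (\<lambda>\<theta>. \<Sum>n. f n \<theta>) k"
  proof -
    have "summable (\<lambda>n. f n \<theta>)" for \<theta>
      using M by (rule summable_comparison_test'[where N = 0, rotated])
    then have "(\<Sum>n. f n \<theta> * echar (- k) \<theta>) = (\<Sum>n. f n \<theta>) * echar (- k) \<theta>" for \<theta>
      by (rule suminf_mult2[symmetric])
    then show ?thesis using integral_unique[OF L] by (simp add: ccoeff_def)
  qed
  ultimately show "(\<lambda>n. ccoeff (f n) k) sums ccoeff (\<lambda>\<theta>. \<Sum>n. f n \<theta>) k"
    using \<open>I \<longlonglongrightarrow> L\<close> by (simp add: sums_def)
qed

section \<open>Functions with positive frequencies only\<close>

text \<open>The periodic functions of this kind are the boundary values of holomorphic functions on the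
  unit disc that are continuous up to the boundary and vanish at the origin. Excluding the
  frequency 0 is what makes the real members trivial.\<close>

definition hardy :: "(real \<Rightarrow> complex) \<Rightarrow> bool" where
  "hardy g \<longleftrightarrow> continuous_on UNIV g \<and> (\<forall>n\<le>0. ccoeff g n = 0)"

lemma hardy_add:
  assumes "hardy f" "hardy g"
  shows "hardy (\<lambda>\<theta>. f \<theta> + g \<theta>)"
  using assms by (auto simp: hardy_def ccoeff_add intro: continuous_intros)

lemma hardy_cmult:
  assumes "hardy f"
  shows "hardy (\<lambda>\<theta>. c * f \<theta>)"
  using assms by (auto simp: hardy_def ccoeff_cmult intro: continuous_intros)

lemma hardy_echar_mult:
  assumes "hardy f" "k \<ge> 0"
  shows "hardy (\<lambda>\<theta>. echar k \<theta> * f \<theta>)"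
  using assms by (auto simp: hardy_def ccoeff_echar_mult intro: continuous_intros)

lemma hardy_suminf:
  assumes "\<And>n. hardy (f n)" "\<And>n \<theta>. norm (f n \<theta>) \<le> M n" "summable M"
  shows "hardy (\<lambda>\<theta>. \<Sum>n. f n \<theta>)"
proof -
  have cont: "continuous_on UNIV (f n)" for n using assms(1) by (simp add: hardy_def)
  have "ccoeff (\<lambda>\<theta>. \<Sum>n. f n \<theta>) k = 0" if "k \<le> 0" for k
    using ccoeff_suminf(2)[OF cont assms(2,3), of k] assms(1) that sums_unique2[OF _ sums_zero]
    by (auto simp: hardy_def)
  then show ?thesis using ccoeff_suminf(1)[OF cont assms(2,3)] by (simp add: hardy_def)
qed

text \<open>The coefficients of a real function are symmetric under \<open>n \<mapsto> - n\<close> up to conjugation, so if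
  the nonpositive ones vanish, all do. The formula for the force is concluded from this: both of
  its sides are real, and their difference has positive frequencies only.\<close>

lemma real_hardy_eq_0:
  assumes "hardy (\<lambda>\<theta>. complex_of_real (f \<theta>))" "periodic1 f"
  shows "f \<theta> = 0"
proof (rule fourier_uniqueness[where f = f])
  have "continuous_on UNIV (\<lambda>\<theta>. Re (complex_of_real (f \<theta>)))"
    using assms(1) by (intro continuous_intros) (simp add: hardy_def)
  then show "continuous_on UNIV f" by simp
  show "fourier_coeff f n = 0" for n
  proof (cases "n \<le> 0")
    case True
    then show ?thesis using assms(1) by (simp add: hardy_def fourier_coeff_eq_ccoeff)
  next
    case False
    then have "fourier_coeff f (- n) = 0" using assms(1) by (simp add: hardy_def fourier_coeff_eq_ccoeff)
    then show ?thesis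
      using cnj_ccoeff[of "\<lambda>\<theta>. complex_of_real (f \<theta>)" "- n"] by (simp add: fourier_coeff_eq_ccoeff)
  qed
qed fact

text \<open>A power series without constant term on the unit circle; \<open>c n\<close> belongs to the frequency
  \<open>n + 1\<close>.\<close>

definition pos_series :: "(nat \<Rightarrow> complex) \<Rightarrow> real \<Rightarrow> complex" where
  "pos_series c \<theta> = (\<Sum>n. c n * echar (int (Suc n)) \<theta>)"

lemma summable_pos_series:
  assumes "summable (\<lambda>n. norm (c n))"
  shows "summable (\<lambda>n. c n * echar (int (Suc n)) \<theta>)"
  by (rule summable_comparison_test'[where N = 0, OF assms]) (simp add: norm_mult)

lemma norm_pos_series_le:
  assumes "summable (\<lambda>n. norm (c n))"
  shows "norm (pos_series c \<theta>) \<le> (\<Sum>n. norm (c n))"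
  unfolding pos_series_def using assms
  by (intro order_trans[OF summable_norm]) (auto simp: norm_mult)

lemma pos_series_mult_hardy:
  assumes c: "summable (\<lambda>n. norm (c n))" and g: "hardy g" and B: "\<And>\<theta>. norm (g \<theta>) \<le> B"
  shows "hardy (\<lambda>\<theta>. pos_series c \<theta> * g \<theta>)"
proof -
  have "hardy (\<lambda>\<theta>. \<Sum>n. c n * (echar (int (Suc n)) \<theta> * g \<theta>))"
  proof (rule hardy_suminf)
    show "norm (c n * (echar (int (Suc n)) \<theta> * g \<theta>)) \<le> norm (c n) * B" for n \<theta>
      using B by (auto simp: norm_mult intro: mult_left_mono)
    show "summable (\<lambda>n. norm (c n) * B)" using c by (rule summable_mult2)
  qed (intro hardy_cmult hardy_echar_mult g; simp)
  also have "(\<lambda>\<theta>. \<Sum>n. c n * (echar (int (Suc n)) \<theta> * g \<theta>)) = (\<lambda>\<theta>. pos_series c \<theta> * g \<theta>)"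
    unfolding pos_series_def
    by (subst suminf_mult2[OF summable_pos_series[OF c]]) (simp add: mult.assoc)
  finally show ?thesis .
qed

lemma hardy_echar:
  assumes "k \<ge> 1" shows "hardy (echar k)"
  using assms by (auto simp: hardy_def ccoeff_echar intro: continuous_intros)

lemma hardy_pos_series:
  assumes c: "summable (\<lambda>n. norm (c n))"
  shows "hardy (pos_series c)"
  unfolding pos_series_def
proof (rule hardy_suminf[OF _ _ c])
  show "hardy (\<lambda>\<theta>. c n * echar (int (Suc n)) \<theta>)" for n
    by (intro hardy_cmult hardy_echar) simp
qed (simp add: norm_mult)

lemma ccoeff_pos_series:
  assumes c: "summable (\<lambda>n. norm (c n))"
  shows "ccoeff (pos_series c) (int (Suc k)) = c k"
proof -
  have "(\<lambda>n. ccoeff (\<lambda>\<theta>. c n * echar (int (Suc n)) \<theta>) (int (Suc k))) sums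
          ccoeff (pos_series c) (int (Suc k))"
    unfolding pos_series_def
    by (rule ccoeff_suminf(2)[OF _ _ c]) (auto intro!: continuous_intros simp: norm_mult)
  moreover have "ccoeff (\<lambda>\<theta>. c n * echar (int (Suc n)) \<theta>) (int (Suc k)) = (if n = k then c n else 0)" for n
    by (subst ccoeff_cmult) (auto simp: ccoeff_echar)
  ultimately have "(\<lambda>n. if n = k then c n else 0) sums ccoeff (pos_series c) (int (Suc k))" by simp
  then show ?thesis using sums_unique2 sums_single[of k c] by blast
qed

lemma periodic1_pos_series: "periodic1 (pos_series c)"
proof -
  have "echar n (\<theta> + 1) = echar n \<theta>" for n \<theta>
    using echar_at_1[of n] by (simp add: echar_def distrib_left flip: cis_mult)
  then show ?thesis by (simp add: periodic1_def pos_series_def)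
qed

section \<open>Fourier inversion and the Hilbert transform\<close>

text \<open>The projection to the positive frequencies. For real \<open>f\<close> it carries the whole function and
  its Hilbert transform: \<open>f + \<i> H f\<close> is the mean of \<open>f\<close> plus twice the analytic part.\<close>

definition analytic_part :: "(real \<Rightarrow> real) \<Rightarrow> real \<Rightarrow> complex" where
  "analytic_part f = pos_series (\<lambda>n. fourier_coeff f (int (Suc n)))"

lemma cnj_fourier_coeff: "cnj (fourier_coeff f n) = fourier_coeff f (- n)"
  by (simp add: fourier_coeff_eq_ccoeff cnj_ccoeff)

lemma fourier_inversion:
  assumes cont: "continuous_on UNIV f" and per: "periodic1 f"
    and c: "summable (\<lambda>n. norm (fourier_coeff f (int (Suc n))))"
  shows "f \<theta> = Re (fourier_coeff f 0) + 2 * Re (analytic_part f \<theta>)"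
proof -
  define p where "p = analytic_part f"
  define S where "S = (\<lambda>\<theta>. Re (fourier_coeff f 0) + 2 * Re (p \<theta>))"
  have hp: "hardy p" unfolding p_def analytic_part_def by (rule hardy_pos_series[OF c])
  then have pc: "continuous_on UNIV p" by (simp add: hardy_def)
  have S: "complex_of_real (S \<theta>) = complex_of_real (Re (fourier_coeff f 0)) * 1 + p \<theta> + cnj (p \<theta>)" for \<theta>
    by (simp add: S_def complex_eq_iff)
  have f0: "complex_of_real (Re (fourier_coeff f 0)) = fourier_coeff f 0"
    using cnj_fourier_coeff[of f 0] by (simp add: complex_eq_iff)
  have coeffS: "ccoeff (\<lambda>\<theta>. complex_of_real (S \<theta>)) n =
      (if n = 0 then fourier_coeff f 0 else 0) + ccoeff p n + cnj (ccoeff p (- n))" for n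
    unfolding S
    by (subst ccoeff_add, (intro continuous_intros pc)+, subst ccoeff_add, (intro continuous_intros pc)+,
        subst ccoeff_cmult) (simp add: ccoeff_1 f0 cnj_ccoeff)
  have pos: "fourier_coeff (\<lambda>\<theta>. f \<theta> - S \<theta>) n = 0" if "n \<ge> 0" for n
  proof -
    have Sc: "continuous_on UNIV S" unfolding S_def by (intro continuous_intros pc)
    have "fourier_coeff (\<lambda>\<theta>. f \<theta> - S \<theta>) n
        = ccoeff (\<lambda>\<theta>. complex_of_real (f \<theta>) + (- 1) * complex_of_real (S \<theta>)) n"
      by (simp add: fourier_coeff_eq_ccoeff)
    also have "\<dots> = fourier_coeff f n - ccoeff (\<lambda>\<theta>. complex_of_real (S \<theta>)) n"
      by (subst ccoeff_add, (intro continuous_intros cont Sc)+, subst ccoeff_cmult)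
         (simp add: fourier_coeff_eq_ccoeff)
    also have "\<dots> = 0"
    proof (cases "n = 0")
      case True
      then show ?thesis using hp by (simp add: coeffS hardy_def)
    next
      case False
      then obtain k where k: "n = int (Suc k)" using \<open>n \<ge> 0\<close>
        by (metis nonneg_int_cases not0_implies_Suc of_nat_0)
      have "ccoeff p n = fourier_coeff f n"
        unfolding k p_def analytic_part_def by (rule ccoeff_pos_series[OF c])
      moreover have "ccoeff p (- n) = 0" using hp \<open>n \<ge> 0\<close> by (simp add: hardy_def)
      ultimately show ?thesis using False by (simp add: coeffS)
    qed
    finally show ?thesis .
  qed
  have "f \<theta> - S \<theta> = 0"
  proof (rule fourier_uniqueness[where f = "\<lambda>\<theta>. f \<theta> - S \<theta>"])
    show "continuous_on UNIV (\<lambda>\<theta>. f \<theta> - S \<theta>)" unfolding S_def by (intro continuous_intros pc cont)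
    show "periodic1 (\<lambda>\<theta>. f \<theta> - S \<theta>)"
      using per periodic1_pos_series by (simp add: periodic1_def S_def p_def analytic_part_def)
    show "fourier_coeff (\<lambda>\<theta>. f \<theta> - S \<theta>) n = 0" for n
      using pos[of n] pos[of "- n"] cnj_fourier_coeff[of "\<lambda>\<theta>. f \<theta> - S \<theta>" n]
      by (cases "n \<ge> 0") auto
  qed
  then show ?thesis by (simp add: S_def p_def)
qed

text \<open>The summands for \<open>n\<close> and \<open>- n\<close> are conjugate to each other and the one for 0 vanishes, so
  the sum over the integers is twice the real part of the sum over the positive ones.\<close>

lemma hilbert_eq_Im_analytic_part:
  assumes c: "summable (\<lambda>n. norm (fourier_coeff f (int (Suc n))))"
  shows "hilbert f \<theta> = 2 * Im (analytic_part f \<theta>)"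
proof -
  define a where "a = (\<lambda>n::int. - \<i> * of_int (sgn n) * fourier_coeff f n * cis (2 * pi * real_of_int n * \<theta>))"
  define P where "P = analytic_part f \<theta>"
  have aneg: "a (- n) = cnj (a n)" for n
    by (simp add: a_def cnj_fourier_coeff cis_cnj)
  have "(\<lambda>n. a (int (Suc n))) = (\<lambda>n. - \<i> * (fourier_coeff f (int (Suc n)) * echar (int (Suc n)) \<theta>))"
    by (simp add: a_def echar_def sgn_if fun_eq_iff mult_ac)
  moreover have "(\<lambda>n. - \<i> * (fourier_coeff f (int (Suc n)) * echar (int (Suc n)) \<theta>)) sums (- \<i> * P)"
    unfolding P_def analytic_part_def pos_series_def
    by (intro sums_mult summable_sums summable_pos_series c)
  ultimately have s: "(\<lambda>n. a (int (Suc n))) sums (- \<i> * P)" by simp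
  have nrm: "summable (\<lambda>n. norm (a (int (Suc n))))"
    using c by (simp add: a_def norm_mult sgn_if)
  have "((\<lambda>n. a (int (Suc n))) has_sum (- \<i> * P)) UNIV"
    by (rule norm_summable_imp_has_sum[OF nrm s])
  then have 1: "(a has_sum (- \<i> * P)) (range (\<lambda>n. int (Suc n)))"
    by (subst has_sum_reindex) (auto simp: inj_on_def o_def)
  have s': "(\<lambda>n. a (- int (Suc n))) sums cnj (- \<i> * P)"
    unfolding aneg using s by (simp only: sums_cnj)
  have nrm': "summable (\<lambda>n. norm (a (- int (Suc n))))" unfolding aneg using nrm by simp
  have "((\<lambda>n. a (- int (Suc n))) has_sum cnj (- \<i> * P)) UNIV"
    by (rule norm_summable_imp_has_sum[OF nrm' s'])
  then have 2: "(a has_sum cnj (- \<i> * P)) (range (\<lambda>n. - int (Suc n)))"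
    by (subst has_sum_reindex) (auto simp: inj_on_def o_def)
  have "(a has_sum (- \<i> * P + cnj (- \<i> * P))) (range (\<lambda>n. int (Suc n)) \<union> range (\<lambda>n. - int (Suc n)))"
    by (rule has_sum_Un_disjoint[OF 1 2]) auto
  also have "?this \<longleftrightarrow> (a has_sum (- \<i> * P + cnj (- \<i> * P))) UNIV"
  proof (rule has_sum_cong_neutral)
    fix x :: int assume "x \<in> UNIV - (range (\<lambda>n. int (Suc n)) \<union> range (\<lambda>n. - int (Suc n)))"
    then have "x \<noteq> int (Suc (nat (x - 1)))" "x \<noteq> - int (Suc (nat (- x - 1)))" by blast+
    then have "x = 0" by linarith
    then show "a x = 0" by (simp add: a_def)
  qed auto
  finally have "infsum a UNIV = - \<i> * P + cnj (- \<i> * P)" by (rule infsumI)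
  then show ?thesis unfolding hilbert_def a_def P_def by simp
qed

section \<open>Decay of Fourier coefficients\<close>

text \<open>Here \<open>d k\<close> is the \<open>k\<close>-th derivative of a smooth function \<open>d 0\<close> on the circle. Carrying the
  whole sequence avoids iterated uses of \<open>deriv\<close> and matches the way in which smoothness in time
  and space is given.\<close>

definition smooth_periodic :: "(nat \<Rightarrow> real \<Rightarrow> real) \<Rightarrow> bool" where
  "smooth_periodic d \<longleftrightarrow>
     (\<forall>k. periodic1 (d k) \<and> (\<forall>\<theta>. (d k has_real_derivative d (Suc k) \<theta>) (at \<theta>)))"

lemma smooth_periodic_continuous: "smooth_periodic d \<Longrightarrow> continuous_on A (d k)"
  by (rule continuous_at_imp_continuous_on) (auto simp: smooth_periodic_def intro: DERIV_isCont)

lemma smooth_periodic_shift: "smooth_periodic d \<Longrightarrow> smooth_periodic (\<lambda>k. d (j + k))"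
  by (simp add: smooth_periodic_def)

lemma fourier_coeff_deriv:
  assumes "smooth_periodic d"
  shows "fourier_coeff (d (Suc k)) n = 2 * pi * \<i> * of_int n * fourier_coeff (d k) n"
proof -
  let ?c = "2 * pi * \<i> * of_int n"
  have der: "(d k has_real_derivative d (Suc k) \<theta>) (at \<theta> within {0..1})" for \<theta>
    by (rule has_field_derivative_at_within) (use assms in \<open>simp add: smooth_periodic_def\<close>)
  have "((\<lambda>\<theta>. of_real (d k \<theta>) * echar (- n) \<theta>) has_vector_derivative
      of_real (d k \<theta>) * (2 * pi * \<i> * of_int (- n) * echar (- n) \<theta>)
        + of_real (d (Suc k) \<theta>) * echar (- n) \<theta>) (at \<theta> within {0..1})" for \<theta>
    by (intro has_vector_derivative_mult has_vector_derivative_echar has_vector_derivative_of_real der)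
  then have "((\<lambda>\<theta>. of_real (d k \<theta>) * (2 * pi * \<i> * of_int (- n) * echar (- n) \<theta>)
        + of_real (d (Suc k) \<theta>) * echar (- n) \<theta>) has_integral
      (of_real (d k 1) * echar (- n) 1 - of_real (d k 0) * echar (- n) 0)) {0..1}"
    by (intro fundamental_theorem_of_calculus) auto
  moreover have "d k 1 = d k 0"
    using assms by (auto simp: smooth_periodic_def periodic1_def dest!: spec[of _ k] spec[of _ "0::real"])
  moreover have "echar (- n) 0 = 1" by (simp add: echar_def)
  ultimately have "((\<lambda>\<theta>. (- ?c) * of_real (d k \<theta>) * echar (- n) \<theta>
        + of_real (d (Suc k) \<theta>) * echar (- n) \<theta>) has_integral 0) {0..1}"
    by (simp add: mult_ac)
  then have "ccoeff (\<lambda>\<theta>. (- ?c) * of_real (d k \<theta>) + of_real (d (Suc k) \<theta>)) n = 0"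
    unfolding ccoeff_def distrib_right by (rule integral_unique)
  moreover have "ccoeff (\<lambda>\<theta>. (- ?c) * of_real (d k \<theta>) + of_real (d (Suc k) \<theta>)) n
     = (- ?c) * fourier_coeff (d k) n + fourier_coeff (d (Suc k)) n"
    unfolding fourier_coeff_eq_ccoeff
    by (subst ccoeff_add, (intro continuous_intros smooth_periodic_continuous[OF assms])+,
        subst ccoeff_cmult) (rule refl)
  ultimately show ?thesis by simp
qed

lemma fourier_coeff_mean_deriv:
  assumes "smooth_periodic d"
  shows "fourier_coeff (d (Suc k)) 0 = 0"
  by (simp add: fourier_coeff_deriv[OF assms])

text \<open>Each derivative multiplies the coefficient of frequency \<open>n + 1\<close> by a number of modulus
  \<open>2 pi (n + 1)\<close>, of which the factor \<open>2 pi\<close> is dropped. The constant is explicit because it is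
  needed uniformly in time later.\<close>

lemma fourier_coeff_decay:
  assumes d: "smooth_periodic d" and C: "\<And>\<theta>. \<theta> \<in> {0..1} \<Longrightarrow> \<bar>d k \<theta>\<bar> \<le> C"
  shows "norm (fourier_coeff (d 0) (int (Suc n))) * real (Suc n) ^ k \<le> C"
proof -
  have "norm (fourier_coeff (d 0) (int (Suc n))) * real (Suc n) ^ k
          \<le> norm (fourier_coeff (d k) (int (Suc n)))"
  proof (induction k)
    case (Suc k)
    have "1 \<le> 2 * pi" using pi_gt3 by simp
    have "norm (fourier_coeff (d 0) (int (Suc n))) * real (Suc n) ^ Suc k
        \<le> norm (fourier_coeff (d k) (int (Suc n))) * real (Suc n)"
      using mult_right_mono[OF Suc.IH, of "real (Suc n)"] by (simp add: mult_ac)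
    also have "\<dots> \<le> (2 * pi) * (norm (fourier_coeff (d k) (int (Suc n))) * real (Suc n))"
      using mult_right_mono[OF \<open>1 \<le> 2 * pi\<close>, of "norm (fourier_coeff (d k) (int (Suc n))) * real (Suc n)"]
      by simp
    also have "\<dots> = norm (fourier_coeff (d (Suc k)) (int (Suc n)))"
      by (subst fourier_coeff_deriv[OF d]) (simp add: norm_mult del: of_nat_Suc)
    finally show ?case .
  qed simp
  also have "\<dots> \<le> C"
    unfolding fourier_coeff_eq_ccoeff
    by (rule norm_ccoeff_le) (auto intro!: continuous_intros smooth_periodic_continuous[OF d] C)
  finally show ?thesis .
qed

lemma smooth_periodic_bounded:
  assumes d: "smooth_periodic d"
  obtains C where "\<And>\<theta>. \<theta> \<in> {0..1} \<Longrightarrow> \<bar>d k \<theta>\<bar> \<le> C"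
proof -
  have "bounded (d k ` {0..1})"
    by (intro compact_imp_bounded compact_continuous_image smooth_periodic_continuous[OF d]) auto
  then obtain C where C: "\<forall>\<theta>\<in>{0..1}. \<bar>d k \<theta>\<bar> \<le> C"
    by (auto simp: bounded_iff)
  show ?thesis by (rule that[of C]) (use C in blast)
qed

lemma summable_inverse_squares: "summable (\<lambda>n. C / real (Suc n) ^ 2)"
proof -
  have "summable (\<lambda>n. 1 / real (Suc n) ^ 2)"
    using inverse_power_summable[of 2, where 'a = real] summable_Suc_iff[of "\<lambda>n. inverse (real n ^ 2)"]
    by (simp add: inverse_eq_divide del: of_nat_Suc)
  from summable_mult[OF this, of C] show ?thesis by simp
qed

lemma summable_fourier_coeff:
  assumes d: "smooth_periodic d"
  shows "summable (\<lambda>n. norm (fourier_coeff (d k) (int (Suc n))))"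
proof -
  obtain C where C: "\<And>\<theta>. \<theta> \<in> {0..1} \<Longrightarrow> \<bar>d (k + 2) \<theta>\<bar> \<le> C"
    using smooth_periodic_bounded[OF d] by blast
  have le: "norm (fourier_coeff (d k) (int (Suc n))) \<le> C / real (Suc n) ^ 2" for n
    using fourier_coeff_decay[OF smooth_periodic_shift[OF d, of k], where k = 2 and C = C and n = n] C
    by (simp add: field_simps del: of_nat_Suc)
  show ?thesis
    by (rule summable_comparison_test'[where N = 0, OF summable_inverse_squares[of C]]) (use le in simp)
qed

section \<open>The positivity identity\<close>

text \<open>The part of \<open>pos_series c\<close> with frequencies at least \<open>l + 1\<close>.\<close>

definition tail_series :: "(nat \<Rightarrow> complex) \<Rightarrow> nat \<Rightarrow> real \<Rightarrow> complex" where
  "tail_series c l \<theta> = (\<Sum>j. c (j + l) * echar (int (Suc (j + l))) \<theta>)"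

lemma tail_series_0: "tail_series c 0 = pos_series c"
  by (simp add: tail_series_def pos_series_def fun_eq_iff)

lemma summable_shift_norm:
  fixes c :: "nat \<Rightarrow> complex"
  shows "summable (\<lambda>n. norm (c n)) \<Longrightarrow> summable (\<lambda>j. norm (c (j + l)))"
  by (subst summable_iff_shift[of "\<lambda>n. norm (c n)"])

lemma tail_series_eq_pos_series:
  assumes "summable (\<lambda>n. norm (c n))"
  shows "tail_series c l \<theta> = echar (int l) \<theta> * pos_series (\<lambda>j. c (j + l)) \<theta>"
proof -
  have "c (j + l) * echar (int (Suc (j + l))) \<theta>
      = echar (int l) \<theta> * (c (j + l) * echar (int (Suc j)) \<theta>)" for j
    using echar_mult[of "int l" \<theta> "int (Suc j)"] by (simp add: mult_ac add_ac)
  then show ?thesis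
    unfolding tail_series_def pos_series_def
    by (simp only: suminf_mult[OF summable_pos_series[OF summable_shift_norm[OF assms]]])
qed

lemma tail_series_step:
  assumes "summable (\<lambda>n. norm (c n))"
  shows "tail_series c l \<theta> = c l * echar (int (Suc l)) \<theta> + tail_series c (Suc l) \<theta>"
proof -
  have "summable (\<lambda>j. c (j + l) * echar (int (Suc (j + l))) \<theta>)"
    using summable_pos_series[OF assms, of \<theta>]
    by (subst summable_iff_shift[of "\<lambda>n. c n * echar (int (Suc n)) \<theta>"])
  from suminf_split_head[OF this] show ?thesis
    by (simp add: tail_series_def)
qed

lemma pos_series_minus_tail:
  assumes "summable (\<lambda>n. norm (c n))"
  shows "pos_series c \<theta> - tail_series c l \<theta> = (\<Sum>i<l. c i * echar (int (Suc i)) \<theta>)"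
proof (induction l)
  case (Suc l)
  then show ?case using tail_series_step[OF assms, of l \<theta>] by (simp add: algebra_simps)
qed (simp add: tail_series_0)

text \<open>Summation by parts, with \<open>2 l + 1 = (l + 1)^2 - l^2\<close>.\<close>

lemma sum_odd_tail_series:
  assumes "summable (\<lambda>n. norm (c n))"
  shows "(\<Sum>l<N. of_nat (2 * l + 1) * tail_series c l \<theta>)
       = of_nat N ^ 2 * tail_series c N \<theta> + (\<Sum>l<N. of_nat (Suc l) ^ 2 * c l * echar (int (Suc l)) \<theta>)"
proof (induction N)
  case (Suc N)
  have "(\<Sum>l<Suc N. of_nat (2 * l + 1) * tail_series c l \<theta>)
      = of_nat (Suc N) ^ 2 * tail_series c N \<theta> + (\<Sum>l<N. of_nat (Suc l) ^ 2 * c l * echar (int (Suc l)) \<theta>)"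
    unfolding sum.lessThan_Suc Suc.IH by (simp add: power2_eq_square algebra_simps)
  then show ?case
    unfolding tail_series_step[OF assms, of N] by (simp add: algebra_simps)
qed simp

text \<open>The fifth power lets the tails decay like the inverse cube, so that the tails weighted by
  \<open>2 l + 1\<close> are still summable.\<close>

locale rapidly_decaying =
  fixes c :: "nat \<Rightarrow> complex" and C :: real
  assumes decay: "norm (c n) * real (Suc n) ^ 5 \<le> C"
begin

definition tail_const where "tail_const = (\<Sum>j. C / real (Suc j) ^ 2)"

lemma norm_le: "norm (c (j + l)) \<le> C / real (Suc j) ^ 2 / real (Suc l) ^ 3"
proof -
  have "real (Suc j) ^ 2 * real (Suc l) ^ 3 \<le> real (Suc (j + l)) ^ 2 * real (Suc (j + l)) ^ 3"
    by (intro mult_mono power_mono) auto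
  also have "\<dots> = real (Suc (j + l)) ^ 5" by (simp flip: power_add)
  finally have "norm (c (j + l)) * (real (Suc j) ^ 2 * real (Suc l) ^ 3) \<le> norm (c (j + l)) * real (Suc (j + l)) ^ 5"
    by (rule mult_left_mono) simp
  also have "\<dots> \<le> C" by (rule decay)
  finally show ?thesis by (simp add: field_simps del: of_nat_Suc)
qed

lemma summable_sq: "summable (\<lambda>n. norm (of_nat (Suc n) ^ 2 * c n))"
proof (rule summable_comparison_test'[where N = 0, OF summable_inverse_squares[of C]])
  fix n
  have "norm (c n) * real (Suc n) ^ 4 \<le> norm (c n) * real (Suc n) ^ 5"
    by (intro mult_left_mono power_increasing) auto
  also have "\<dots> \<le> C" by (rule decay)
  finally have "norm (c n) * real (Suc n) ^ 4 \<le> C" .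
  also have "norm (c n) * real (Suc n) ^ 4 = real (Suc n) ^ 2 * norm (c n) * real (Suc n) ^ 2"
    by (simp only: mult_ac flip: power_add) (simp add: mult_ac)
  finally have "real (Suc n) ^ 2 * norm (c n) \<le> C / real (Suc n) ^ 2"
    by (rule mult_imp_le_div_pos[rotated]) simp
  then show "norm (norm (of_nat (Suc n) ^ 2 * c n)) \<le> C / real (Suc n) ^ 2"
    by (simp add: norm_mult norm_power del: of_nat_Suc)
qed

lemma summable_norm_c: "summable (\<lambda>n. norm (c n))"
  by (rule summable_comparison_test'[where N = 0, OF summable_inverse_squares[of C]])
     (use norm_le[of _ 0] in simp)

lemma norm_tail_le: "norm (tail_series c l \<theta>) \<le> tail_const / real (Suc l) ^ 3"
proof -
  have le: "norm (c (j + l) * echar (int (Suc (j + l))) \<theta>) \<le> C / real (Suc j) ^ 2 / real (Suc l) ^ 3" for j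
    using norm_le[of j l] by (simp add: norm_mult)
  have s: "summable (\<lambda>j. C / real (Suc j) ^ 2 / real (Suc l) ^ 3)"
    by (intro summable_divide summable_inverse_squares)
  have "norm (tail_series c l \<theta>) \<le> (\<Sum>j. C / real (Suc j) ^ 2 / real (Suc l) ^ 3)"
    unfolding tail_series_def by (rule norm_suminf_le[OF le s])
  also have "\<dots> = tail_const / real (Suc l) ^ 3"
    unfolding tail_const_def by (rule suminf_divide[OF summable_inverse_squares])
  finally show ?thesis .
qed

lemma tail_const_nonneg: "tail_const \<ge> 0"
  using norm_tail_le[of 0 0] order_trans[OF norm_ge_zero] by simp

lemma norm_tail_le_const: "norm (tail_series c l \<theta>) \<le> tail_const"
proof -
  have "tail_const * 1 \<le> tail_const * real (Suc l) ^ 3" by (intro mult_left_mono tail_const_nonneg one_le_power) simp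
  then have "tail_const / real (Suc l) ^ 3 \<le> tail_const" by (simp add: divide_le_eq del: of_nat_Suc)
  with norm_tail_le show ?thesis by (rule order_trans)
qed

lemma weighted_tail_le: "real (2 * l + 1) * norm (tail_series c l \<theta>) \<le> 2 * tail_const / real (Suc l) ^ 2"
proof -
  have "real (2 * l + 1) * norm (tail_series c l \<theta>) \<le> (2 * real (Suc l)) * (tail_const / real (Suc l) ^ 3)"
    by (intro mult_mono norm_tail_le) auto
  also have "\<dots> = 2 * tail_const / real (Suc l) ^ 2"
    by (simp add: power3_eq_cube power2_eq_square del: of_nat_Suc)
  finally show ?thesis .
qed

text \<open>Up to the factor \<open>- 4 pi^2\<close> the right hand side is the second derivative of
  \<open>pos_series c\<close>.\<close>

lemma sums_odd_tail_series:
  "(\<lambda>l. of_nat (2 * l + 1) * tail_series c l \<theta>) sums pos_series (\<lambda>n. of_nat (Suc n) ^ 2 * c n) \<theta>"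
proof -
  have "(\<lambda>N. of_nat N ^ 2 * tail_series c N \<theta>) \<longlonglongrightarrow> 0"
  proof (rule Lim_null_comparison)
    show "\<forall>\<^sub>F N in sequentially. norm (of_nat N ^ 2 * tail_series c N \<theta>) \<le> tail_const * inverse (real (Suc N))"
    proof (intro always_eventually allI)
      fix N
      have "norm (of_nat N ^ 2 * tail_series c N \<theta>) \<le> real (Suc N) ^ 2 * (tail_const / real (Suc N) ^ 3)"
        unfolding norm_mult norm_power norm_of_nat
        by (intro mult_mono power_mono norm_tail_le) auto
      also have "\<dots> = tail_const * inverse (real (Suc N))"
        by (simp add: power3_eq_cube power2_eq_square field_simps del: of_nat_Suc)
      finally show "norm (of_nat N ^ 2 * tail_series c N \<theta>) \<le> tail_const * inverse (real (Suc N))" .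
    qed
    show "(\<lambda>N. tail_const * inverse (real (Suc N))) \<longlonglongrightarrow> 0"
      using tendsto_mult[OF tendsto_const[of tail_const] LIMSEQ_inverse_real_of_nat] by simp
  qed
  moreover have "(\<lambda>N. \<Sum>l<N. of_nat (Suc l) ^ 2 * c l * echar (int (Suc l)) \<theta>)
      \<longlonglongrightarrow> pos_series (\<lambda>n. of_nat (Suc n) ^ 2 * c n) \<theta>"
    using summable_sums[OF summable_pos_series[OF summable_sq, of \<theta>]]
    by (simp add: sums_def pos_series_def)
  ultimately show ?thesis
    unfolding sums_def sum_odd_tail_series[OF summable_norm_c]
    using tendsto_add by fastforce
qed

text \<open>When \<open>c\<close> consists of the Fourier coefficients of the velocity, \<open>8 pi^2\<close> times this sum of
  squares turns out to be the force of the solar model.\<close>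

definition energy :: "real \<Rightarrow> real" where
  "energy \<theta> = (\<Sum>l. real (2 * l + 1) * (norm (tail_series c l \<theta>))\<^sup>2)"

lemma summable_energy: "summable (\<lambda>l. real (2 * l + 1) * (norm (tail_series c l \<theta>))\<^sup>2)"
proof (rule summable_comparison_test'[where N = 0, OF summable_inverse_squares[of "2 * tail_const * tail_const"]])
  fix l
  have "real (2 * l + 1) * norm (tail_series c l \<theta>) * norm (tail_series c l \<theta>) \<le> 2 * tail_const / real (Suc l) ^ 2 * tail_const"
    by (intro mult_mono weighted_tail_le norm_tail_le_const) (auto simp: tail_const_nonneg)
  then show "norm (real (2 * l + 1) * (norm (tail_series c l \<theta>))\<^sup>2) \<le> 2 * tail_const * tail_const / real (Suc l) ^ 2"
    by (simp add: power2_eq_square mult_ac)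
qed

lemma energy_nonneg: "energy \<theta> \<ge> 0"
  unfolding energy_def by (intro suminf_nonneg summable_energy) simp

lemma energy_eq_0D:
  assumes "energy \<theta> = 0"
  shows "c l = 0"
proof -
  have "\<forall>l. real (2 * l + 1) * (norm (tail_series c l \<theta>))\<^sup>2 = 0"
    using assms suminf_eq_zero_iff[OF summable_energy[of \<theta>]] unfolding energy_def by simp
  then have "tail_series c l \<theta> = 0" for l by (auto dest!: spec[of _ l])
  then have "c l * echar (int (Suc l)) \<theta> = 0"
    using tail_series_step[OF summable_norm_c, of l \<theta>] by simp
  then show ?thesis using norm_echar[of "int (Suc l)" \<theta>] by (metis mult_eq_0_iff norm_zero zero_neq_one)
qed

lemma periodic1_energy: "periodic1 energy"
proof -
  have "norm (tail_series c l (\<theta> + 1)) = norm (tail_series c l \<theta>)" for l \<theta>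
    using periodic1_pos_series[of "\<lambda>j. c (j + l)"]
    unfolding tail_series_eq_pos_series[OF summable_norm_c] periodic1_def by (simp add: norm_mult)
  then show ?thesis unfolding periodic1_def energy_def by presburger
qed

text \<open>The tail has frequencies at least \<open>l + 1\<close>. The second factor is minus the conjugate of the
  initial piece of the series, so its frequencies are at least \<open>- l\<close>.\<close>

lemma hardy_tail_minus_series:
  "hardy (\<lambda>\<theta>. tail_series c l \<theta> * (cnj (tail_series c l \<theta>) - cnj (pos_series c \<theta>)))"
proof -
  have "tail_series c l \<theta> * (cnj (tail_series c l \<theta>) - cnj (pos_series c \<theta>))
      = (\<Sum>i<l. (- cnj (c i)) * (echar (int l - int (Suc i)) \<theta> * pos_series (\<lambda>j. c (j + l)) \<theta>))" for \<theta>
  proof -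
    have "cnj (tail_series c l \<theta>) - cnj (pos_series c \<theta>)
        = - cnj (pos_series c \<theta> - tail_series c l \<theta>)" by simp
    also have "\<dots> = (\<Sum>i<l. (- cnj (c i)) * echar (- int (Suc i)) \<theta>)"
      unfolding pos_series_minus_tail[OF summable_norm_c] by (simp add: sum_negf)
    finally have *: "cnj (tail_series c l \<theta>) - cnj (pos_series c \<theta>) = \<dots>" .
    have "echar (int l - int (Suc i)) \<theta> = echar (int l) \<theta> * echar (- int (Suc i)) \<theta>" for i
      unfolding echar_mult by (rule arg_cong[where f = "\<lambda>n. echar n \<theta>"]) simp
    then show ?thesis unfolding * unfolding tail_series_eq_pos_series[OF summable_norm_c] sum_distrib_left
      by (intro sum.cong refl) (simp only: mult_ac)
  qed
  moreover have "hardy (\<lambda>\<theta>. \<Sum>i<n. (- cnj (c i)) * (echar (int l - int (Suc i)) \<theta> * pos_series (\<lambda>j. c (j + l)) \<theta>))"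
    if "n \<le> l" for n
    using that
  proof (induction n)
    case 0
    then show ?case by (simp add: hardy_def ccoeff_def)
  next
    case (Suc n)
    then show ?case unfolding sum.lessThan_Suc
      by (intro hardy_add hardy_cmult hardy_echar_mult hardy_pos_series
          summable_shift_norm summable_norm_c) auto
  qed
  ultimately show ?thesis by simp
qed

text \<open>Both terms are series over the tails with the weights \<open>2 l + 1\<close>, the second one by
  \<open>sums_odd_tail_series\<close>. Subtracting them term by term leaves the products of the previous
  lemma.\<close>

lemma hardy_energy:
  "hardy (\<lambda>\<theta>. complex_of_real (energy \<theta>)
            - cnj (pos_series c \<theta>) * pos_series (\<lambda>n. of_nat (Suc n) ^ 2 * c n) \<theta>)"
proof -
  let ?t = "tail_series c"
  have "(\<lambda>l. of_nat (2 * l + 1) * (?t l \<theta> * (cnj (?t l \<theta>) - cnj (pos_series c \<theta>)))) sums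
      (complex_of_real (energy \<theta>) - cnj (pos_series c \<theta>) * pos_series (\<lambda>n. of_nat (Suc n) ^ 2 * c n) \<theta>)" for \<theta>
  proof -
    have "(\<lambda>l. complex_of_real (real (2 * l + 1) * (norm (?t l \<theta>))\<^sup>2)) sums complex_of_real (energy \<theta>)"
      unfolding energy_def by (intro sums_of_real summable_sums summable_energy)
    from sums_diff[OF this sums_mult[OF sums_odd_tail_series, of "cnj (pos_series c \<theta>)"]]
    show ?thesis by (simp only: of_real_mult complex_norm_square of_real_of_nat_eq right_diff_distrib mult_ac)
  qed
  then have eq: "(\<lambda>\<theta>. complex_of_real (energy \<theta>)
            - cnj (pos_series c \<theta>) * pos_series (\<lambda>n. of_nat (Suc n) ^ 2 * c n) \<theta>)
     = (\<lambda>\<theta>. \<Sum>l. of_nat (2 * l + 1) * (?t l \<theta> * (cnj (?t l \<theta>) - cnj (pos_series c \<theta>))))"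
    by (intro ext) (rule sums_unique)
  show ?thesis unfolding eq
  proof (rule hardy_suminf)
    show "hardy (\<lambda>\<theta>. of_nat (2 * l + 1) * (?t l \<theta> * (cnj (?t l \<theta>) - cnj (pos_series c \<theta>))))" for l
      by (intro hardy_cmult hardy_tail_minus_series)
    show "summable (\<lambda>l. 4 * tail_const * tail_const / real (Suc l) ^ 2)" by (rule summable_inverse_squares)
    fix l \<theta>
    have "norm (cnj (?t l \<theta>) - cnj (pos_series c \<theta>)) \<le> tail_const + tail_const"
      using norm_triangle_ineq4[of "cnj (?t l \<theta>)" "cnj (pos_series c \<theta>)"]
        norm_tail_le_const[of l \<theta>] norm_tail_le_const[of 0 \<theta>] by (simp add: tail_series_0)
    then have "real (2 * l + 1) * norm (?t l \<theta>) * norm (cnj (?t l \<theta>) - cnj (pos_series c \<theta>))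
        \<le> 2 * tail_const / real (Suc l) ^ 2 * (tail_const + tail_const)"
      by (intro mult_mono weighted_tail_le) (auto simp: tail_const_nonneg)
    then show "norm (of_nat (2 * l + 1) * (?t l \<theta> * (cnj (?t l \<theta>) - cnj (pos_series c \<theta>))))
        \<le> 4 * tail_const * tail_const / real (Suc l) ^ 2"
      unfolding norm_mult norm_of_nat by (simp only: mult_ac) (simp add: mult_ac)
  qed
qed

end

lemma rapidly_decaying_fourier_coeff:
  assumes d: "smooth_periodic d"
  obtains C where "rapidly_decaying (\<lambda>n. fourier_coeff (d 0) (int (Suc n))) C"
proof -
  obtain C where "\<And>\<theta>. \<theta> \<in> {0..1} \<Longrightarrow> \<bar>d 5 \<theta>\<bar> \<le> C" using smooth_periodic_bounded[OF d] by blast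
  then have "rapidly_decaying (\<lambda>n. fourier_coeff (d 0) (int (Suc n))) C"
    by unfold_locales (rule fourier_coeff_decay[OF d])
  then show ?thesis by (rule that)
qed

lemma analytic_part_deriv:
  assumes d: "smooth_periodic d"
  shows "analytic_part (d 2) \<theta>
     = - of_real (4 * pi\<^sup>2) * pos_series (\<lambda>n. of_nat (Suc n) ^ 2 * fourier_coeff (d 0) (int (Suc n))) \<theta>"
proof -
  obtain C where "rapidly_decaying (\<lambda>n. fourier_coeff (d 0) (int (Suc n))) C"
    using rapidly_decaying_fourier_coeff[OF d] by blast
  then interpret rapidly_decaying "\<lambda>n. fourier_coeff (d 0) (int (Suc n))" C .
  have "fourier_coeff (d 2) (int (Suc n)) =
      - of_real (4 * pi\<^sup>2) * (of_nat (Suc n) ^ 2 * fourier_coeff (d 0) (int (Suc n)))" for n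
    using fourier_coeff_deriv[OF d, of 0 "int (Suc n)"] fourier_coeff_deriv[OF d, of 1 "int (Suc n)"]
    by (simp add: numeral_2_eq_2 power2_eq_square algebra_simps)
  then show ?thesis
    unfolding analytic_part_def pos_series_def
    by (simp only: mult.assoc suminf_mult[OF summable_pos_series[OF summable_sq], unfolded mult.assoc])
qed

lemma real_analytic_part_eq_0:
  assumes d: "smooth_periodic d" and zero: "\<And>\<theta>. hilbert (d k) \<theta> = 0"
  shows "analytic_part (d k) \<theta> = 0"
proof -
  let ?p = "analytic_part (d k)"
  have im: "Im (?p \<theta>) = 0" for \<theta>
    using hilbert_eq_Im_analytic_part[OF summable_fourier_coeff[OF d], of k \<theta>] zero by simp
  then have "?p = (\<lambda>\<theta>. complex_of_real (Re (?p \<theta>)))" by (simp add: complex_eq_iff fun_eq_iff)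
  moreover have "hardy ?p"
    unfolding analytic_part_def by (rule hardy_pos_series[OF summable_fourier_coeff[OF d]])
  ultimately have "hardy (\<lambda>\<theta>. complex_of_real (Re (?p \<theta>)))" by simp
  moreover have "periodic1 (\<lambda>\<theta>. Re (?p \<theta>))"
    using periodic1_pos_series by (simp add: periodic1_def analytic_part_def)
  ultimately have "Re (?p \<theta>) = 0" by (rule real_hardy_eq_0)
  with im show ?thesis by (simp add: complex_eq_iff)
qed

text \<open>The force of the solar model as it comes out of differentiating the polar coordinates twice:
  \<open>d k\<close> stands for the \<open>k\<close>-th space derivative of the velocity, \<open>w\<close> for its mixed derivative
  in time and space, and \<open>hilbert (d 1)\<close> for the momentum.\<close>

definition force :: "real \<Rightarrow> (nat \<Rightarrow> real \<Rightarrow> real) \<Rightarrow> (real \<Rightarrow> real) \<Rightarrow> real \<Rightarrow> real" where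
  "force lam d w \<theta> = - (w \<theta> + d 0 \<theta> * d 2 \<theta> + lam / 2 * ((d 1 \<theta>)\<^sup>2 - (hilbert (d 1) \<theta>)\<^sup>2))"

lemma periodic1_hilbert:
  assumes "smooth_periodic d"
  shows "periodic1 (hilbert (d k))"
  using periodic1_pos_series
  unfolding periodic1_def hilbert_eq_Im_analytic_part[OF summable_fourier_coeff[OF assms]] analytic_part_def
  by simp

text \<open>Read \<open>d 0\<close> as \<open>u\<close> and \<open>e 1\<close> as \<open>u\<^sub>t\<^sub>\<theta>\<close>; that it is a derivative provides mean zero.
  With \<open>v = u\<^sub>\<theta>\<close>, the function \<open>G\<close> in the proof is
  \<open>(e 1 + \<i> H (e 1)) + u (v\<^sub>\<theta> + \<i> H v\<^sub>\<theta>) + lam / 2 (v + \<i> H v)^2\<close>. Its real part is minus the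
  force and its imaginary part is the left hand side of the equation. All terms of \<open>G\<close> have
  positive frequencies only, except for the product of the second derivative of the analytic part
  of \<open>u\<close> with the conjugate of the analytic part; adding the energy repairs this one.\<close>

lemma force_eq_energy:
  assumes d: "smooth_periodic d" and e: "smooth_periodic e"
    and pde: "\<And>\<theta>. hilbert (e 1) \<theta> + d 0 \<theta> * hilbert (d 2) \<theta> + lam * d 1 \<theta> * hilbert (d 1) \<theta> = 0"
  shows "force lam d (e 1) \<theta> =
           8 * pi\<^sup>2 * rapidly_decaying.energy (\<lambda>n. fourier_coeff (d 0) (int (Suc n))) \<theta>"
proof -
  let ?c = "\<lambda>n. fourier_coeff (d 0) (int (Suc n))"
  obtain C where "rapidly_decaying ?c C" using rapidly_decaying_fourier_coeff[OF d] by blast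
  then interpret rapidly_decaying ?c C .
  define P where "P = (\<lambda>k. analytic_part (d k))"
  define W where "W = analytic_part (e 1)"
  have hardyP: "hardy (P k)" and hardyW: "hardy W" for k
    unfolding P_def W_def analytic_part_def
    by (intro hardy_pos_series summable_fourier_coeff d e)+
  have PP: "hardy (\<lambda>\<theta>. P j \<theta> * P k \<theta>)" for j k
    unfolding P_def analytic_part_def
    by (rule pos_series_mult_hardy[OF summable_fourier_coeff[OF d]
          hardy_pos_series[OF summable_fourier_coeff[OF d]]
          norm_pos_series_le[OF summable_fourier_coeff[OF d]]])
  have inv: "d k \<theta> = Re (fourier_coeff (d k) 0) + 2 * Re (P k \<theta>)"
    and hil: "hilbert (d k) \<theta> = 2 * Im (P k \<theta>)" for k \<theta>
    unfolding P_def using d summable_fourier_coeff[OF d]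
    by (auto intro!: fourier_inversion hilbert_eq_Im_analytic_part smooth_periodic_continuous
        simp: smooth_periodic_def)
  have inve: "e k \<theta> = Re (fourier_coeff (e k) 0) + 2 * Re (analytic_part (e k) \<theta>)"
    and hile: "hilbert (e k) \<theta> = 2 * Im (analytic_part (e k) \<theta>)" for k \<theta>
    using e summable_fourier_coeff[OF e]
    by (auto intro!: fourier_inversion hilbert_eq_Im_analytic_part smooth_periodic_continuous
        simp: smooth_periodic_def)
  define a where "a = Re (fourier_coeff (d 0) 0)"
  have u: "d 0 \<theta> = a + 2 * Re (P 0 \<theta>)" for \<theta> using inv[of 0 \<theta>] by (simp add: a_def)
  have v: "d 1 \<theta> = 2 * Re (P 1 \<theta>)" and u2: "d 2 \<theta> = 2 * Re (P 2 \<theta>)" and w: "e 1 \<theta> = 2 * Re (W \<theta>)" for \<theta>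
    using inv[of 1 \<theta>] inv[of 2 \<theta>] inve[of 1 \<theta>] fourier_coeff_mean_deriv[OF d, of 0]
      fourier_coeff_mean_deriv[OF d, of 1] fourier_coeff_mean_deriv[OF e, of 0]
    by (simp_all add: numeral_2_eq_2 W_def)
  define G where "G = (\<lambda>\<theta>. 2 * W \<theta> + 2 * complex_of_real (d 0 \<theta>) * P 2 \<theta> + of_real (2 * lam) * (P 1 \<theta> * P 1 \<theta>))"
  have G_real: "G \<theta> = complex_of_real (- force lam d (e 1) \<theta>)" for \<theta>
  proof -
    have "Im (G \<theta>) = 0"
      using pde[of \<theta>] unfolding hil hile v by (simp add: G_def W_def algebra_simps)
    moreover have "Re (G \<theta>) = - force lam d (e 1) \<theta>"
      unfolding force_def hil v u2 w by (simp add: G_def power2_eq_square algebra_simps)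
    ultimately show ?thesis by (simp add: complex_eq_iff)
  qed
  have P2: "P 2 \<theta> = - of_real (4 * pi\<^sup>2) * pos_series (\<lambda>n. of_nat (Suc n) ^ 2 * ?c n) \<theta>" for \<theta>
    unfolding P_def by (rule analytic_part_deriv[OF d])
  have P0: "P 0 = pos_series ?c" by (simp add: P_def analytic_part_def)
  \<comment> \<open>The real constant \<open>a\<close> and the two conjugate halves of \<open>u\<close> are separated, so that the only
    product with a conjugate meets the energy.\<close>
  have split: "complex_of_real (- force lam d (e 1) \<theta> + 8 * pi\<^sup>2 * energy \<theta>) =
      2 * W \<theta> + (of_real (2 * a) * P 2 \<theta> + (2 * (P 0 \<theta> * P 2 \<theta>) + (of_real (2 * lam) * (P 1 \<theta> * P 1 \<theta>)
      + of_real (8 * pi\<^sup>2) * (complex_of_real (energy \<theta>)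
            - cnj (pos_series ?c \<theta>) * pos_series (\<lambda>n. of_nat (Suc n) ^ 2 * ?c n) \<theta>))))" for \<theta>
  proof -
    have cu: "complex_of_real (d 0 \<theta>) = of_real a + P 0 \<theta> + cnj (P 0 \<theta>)"
      by (simp add: u complex_eq_iff)
    have "2 * cnj (P 0 \<theta>) * P 2 \<theta> = - of_real (8 * pi\<^sup>2) * (cnj (pos_series ?c \<theta>) * pos_series (\<lambda>n. of_nat (Suc n) ^ 2 * ?c n) \<theta>)"
      unfolding P2 P0 by simp
    then show ?thesis
      unfolding of_real_add G_real[symmetric] G_def cu of_real_mult[of _ "energy \<theta>"]
      by (simp add: algebra_simps)
  qed
  have "- force lam d (e 1) \<theta> + 8 * pi\<^sup>2 * energy \<theta> = 0"
  proof (rule real_hardy_eq_0[where f = "\<lambda>\<theta>. - force lam d (e 1) \<theta> + 8 * pi\<^sup>2 * energy \<theta>"])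
    show "hardy (\<lambda>\<theta>. complex_of_real (- force lam d (e 1) \<theta> + 8 * pi\<^sup>2 * energy \<theta>))"
      unfolding split by (intro hardy_add hardy_cmult hardyP hardyW PP hardy_energy)
    show "periodic1 (\<lambda>\<theta>. - force lam d (e 1) \<theta> + 8 * pi\<^sup>2 * energy \<theta>)"
      using d e periodic1_energy periodic1_hilbert[OF d, of 1]
      by (simp add: periodic1_def force_def smooth_periodic_def)
  qed
  then show ?thesis by simp
qed

text \<open>If the force vanishes at a single point, all tails vanish there, hence all their differences
  and so all Fourier coefficients of nonzero frequency: the velocity is constant in space and the
  momentum is 0.\<close>

lemma force_pos:
  assumes d: "smooth_periodic d" and e: "smooth_periodic e"
    and pde: "\<And>\<theta>. hilbert (e 1) \<theta> + d 0 \<theta> * hilbert (d 2) \<theta> + lam * d 1 \<theta> * hilbert (d 1) \<theta> = 0"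
  shows "force lam d (e 1) \<theta> \<ge> 0"
    and "force lam d (e 1) \<theta> = 0 \<Longrightarrow> hilbert (d 1) \<theta>' = 0"
proof -
  let ?c = "\<lambda>n. fourier_coeff (d 0) (int (Suc n))"
  obtain C where "rapidly_decaying ?c C" using rapidly_decaying_fourier_coeff[OF d] by blast
  then interpret rapidly_decaying ?c C .
  show "force lam d (e 1) \<theta> \<ge> 0"
    unfolding force_eq_energy[OF d e pde] by (intro mult_nonneg_nonneg energy_nonneg) simp_all
  assume "force lam d (e 1) \<theta> = 0"
  then have "energy \<theta> = 0" unfolding force_eq_energy[OF d e pde] by simp
  then have "?c n = 0" for n by (rule energy_eq_0D)
  then have "fourier_coeff (d 1) (int (Suc n)) = 0" for n
    using fourier_coeff_deriv[OF d, of 0 "int (Suc n)"] by simp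
  then have "analytic_part (d 1) \<theta>' = 0" by (simp add: analytic_part_def pos_series_def)
  then show "hilbert (d 1) \<theta>' = 0"
    by (simp add: hilbert_eq_Im_analytic_part[OF summable_fourier_coeff[OF d]])
qed

text \<open>A function with vanishing Hilbert transform has a real analytic part, which is therefore 0, so
  the function is constant; here the function is a derivative, so that constant is 0.\<close>

lemma hilbert_deriv_eq_0_imp_constant:
  assumes d: "smooth_periodic d" and zero: "\<And>\<theta>. hilbert (d 1) \<theta> = 0"
  shows "d 0 constant_on UNIV"
proof -
  have "d 1 \<theta> = 0" for \<theta>
  proof -
    have "d 1 \<theta> = Re (fourier_coeff (d 1) 0) + 2 * Re (analytic_part (d 1) \<theta>)"
      using d by (intro fourier_inversion smooth_periodic_continuous summable_fourier_coeff)
        (auto simp: smooth_periodic_def)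
    also have "\<dots> = 0"
      using real_analytic_part_eq_0[OF d zero] fourier_coeff_mean_deriv[OF d, of 0] by simp
    finally show ?thesis .
  qed
  then have "(d 0 has_real_derivative 0) (at \<theta>)" for \<theta>
    using d unfolding smooth_periodic_def by (metis One_nat_def)
  then have "d 0 x = d 0 0" for x by (intro DERIV_isconst_all) auto
  then show ?thesis unfolding constant_on_def by blast
qed

section \<open>Regularity of the Hilbert transform of a time-dependent field\<close>

lemma hilbert_has_derivative:
  assumes d: "smooth_periodic d"
  shows "(hilbert (d k) has_real_derivative hilbert (d (Suc k)) \<theta>) (at \<theta>)"
proof -
  let ?c = "\<lambda>k n. fourier_coeff (d k) (int (Suc n))"
  let ?f = "\<lambda>k n \<theta>. 2 * Im (?c k n * echar (int (Suc n)) \<theta>)"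
  have sums: "(\<lambda>n. ?f k n \<theta>) sums hilbert (d k) \<theta>" for k \<theta>
    unfolding hilbert_eq_Im_analytic_part[OF summable_fourier_coeff[OF d]] analytic_part_def pos_series_def
    by (intro sums_mult sums_Im summable_sums summable_pos_series summable_fourier_coeff[OF d])
  have "\<exists>g. \<forall>x\<in>UNIV. (\<lambda>n. ?f k n x) sums g x \<and> (g has_real_derivative hilbert (d (Suc k)) x) (at x within UNIV)"
  proof (rule has_field_derivative_series)
    show "(?f k n has_real_derivative ?f (Suc k) n x) (at x within UNIV)" for n x
    proof -
      have "((\<lambda>x. ?c k n * echar (int (Suc n)) x) has_vector_derivative ?c (Suc k) n * echar (int (Suc n)) x) (at x)"
        by (rule has_vector_derivative_eq_rhs,
            rule has_vector_derivative_mult_right[OF has_vector_derivative_echar])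
           (simp add: fourier_coeff_deriv[OF d])
      from bounded_linear.has_vector_derivative[OF bounded_linear_Im this]
      have "((\<lambda>x. Im (?c k n * echar (int (Suc n)) x)) has_real_derivative Im (?c (Suc k) n * echar (int (Suc n)) x)) (at x)"
        by (simp add: has_real_derivative_iff_has_vector_derivative)
      from DERIV_cmult[OF this, of 2] show ?thesis by simp
    qed
    have "uniform_limit UNIV (\<lambda>n x. \<Sum>i<n. ?f (Suc k) i x) (\<lambda>x. \<Sum>n. ?f (Suc k) n x) sequentially"
    proof (rule Weierstrass_m_test)
      show "norm (?f (Suc k) n x) \<le> 2 * norm (?c (Suc k) n)" for n x
        using abs_Im_le_cmod[of "?c (Suc k) n * echar (int (Suc n)) x"] by (simp add: norm_mult)
      show "summable (\<lambda>n. 2 * norm (?c (Suc k) n))"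
        by (intro summable_mult summable_fourier_coeff[OF d])
    qed
    also have "(\<lambda>x. \<Sum>n. ?f (Suc k) n x) = hilbert (d (Suc k))"
      using sums_unique[OF sums] by (simp add: fun_eq_iff)
    finally show "uniform_limit UNIV (\<lambda>n x. \<Sum>i<n. ?f (Suc k) i x) (hilbert (d (Suc k))) sequentially" .
    show "summable (\<lambda>n. ?f k n 0)" using sums by (rule sums_summable)
  qed auto
  then obtain g where g: "\<And>x. (\<lambda>n. ?f k n x) sums g x"
    and dg: "\<And>x. (g has_real_derivative hilbert (d (Suc k)) x) (at x)" by auto
  have "g = hilbert (d k)" using sums_unique2[OF g sums] by (simp add: fun_eq_iff)
  with dg show ?thesis by simp
qed

text \<open>A smooth time-dependent field on the circle over a compact time interval, with
  \<open>D j k = \<partial>\<^sub>t\<^sup>j \<partial>\<^sub>\<theta>\<^sup>k u\<close>. Compactness of the time interval gives the bounds that are uniform in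
  time; the half-open existence interval is exhausted by such intervals at the end.\<close>

locale smooth_field =
  fixes b :: real and D :: "nat \<Rightarrow> nat \<Rightarrow> real \<Rightarrow> real \<Rightarrow> real"
  assumes b_pos: "b > 0"
    and periodic: "t \<in> {0..b} \<Longrightarrow> periodic1 (D j k t)"
    and cont: "continuous_on ({0..b} \<times> UNIV) (\<lambda>(t, \<theta>). D j k t \<theta>)"
    and dt: "t \<in> {0..b} \<Longrightarrow> ((\<lambda>s. D j k s \<theta>) has_real_derivative D (Suc j) k t \<theta>) (at t within {0..b})"
    and dx: "t \<in> {0..b} \<Longrightarrow> (D j k t has_real_derivative D j (Suc k) t \<theta>) (at \<theta>)"
begin

lemma smooth_periodic_slice: "t \<in> {0..b} \<Longrightarrow> smooth_periodic (\<lambda>k. D j k t)"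
  using periodic dx by (simp add: smooth_periodic_def)

lemma bounded_field:
  obtains C where "C \<ge> 0" "\<And>t \<theta>. t \<in> {0..b} \<Longrightarrow> \<bar>D j k t \<theta>\<bar> \<le> C"
proof -
  have "continuous_on ({0..b} \<times> {0..1}) (\<lambda>(t, \<theta>). D j k t \<theta>)"
    by (rule continuous_on_subset[OF cont]) auto
  then have "bounded ((\<lambda>(t, \<theta>). D j k t \<theta>) ` ({0..b} \<times> {0..1}))"
    by (intro compact_imp_bounded compact_continuous_image compact_Times) auto
  then obtain C where C: "\<forall>x\<in>{0..b} \<times> {0..1}. \<bar>(\<lambda>(t, \<theta>). D j k t \<theta>) x\<bar> \<le> C"
    by (auto simp: bounded_iff)
  have bd: "\<bar>D j k t \<theta>\<bar> \<le> C" if t: "t \<in> {0..b}" for t \<theta>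
  proof -
    obtain \<theta>' where "\<theta>' \<in> {0..1}" "D j k t \<theta> = D j k t \<theta>'"
      using periodic1_unit_interval[OF periodic[OF t]] by blast
    then show ?thesis using C t by (auto dest!: bspec[of _ _ "(t, \<theta>')"])
  qed
  from bd[of 0 0] b_pos have "C \<ge> 0" by simp
  with bd that show ?thesis by blast
qed

lemma fourier_coeff_uniform_decay:
  obtains C where "\<And>t n. t \<in> {0..b} \<Longrightarrow> norm (fourier_coeff (D j k t) (int (Suc n))) \<le> C / real (Suc n) ^ 2"
proof -
  obtain C where C: "\<And>t \<theta>. t \<in> {0..b} \<Longrightarrow> \<bar>D j (k + 2) t \<theta>\<bar> \<le> C" using bounded_field by blast
  have "norm (fourier_coeff (D j k t) (int (Suc n))) \<le> C / real (Suc n) ^ 2" if t: "t \<in> {0..b}" for t n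
    using fourier_coeff_decay[OF smooth_periodic_shift[OF smooth_periodic_slice[OF t, of j], of k],
        where k = 2 and C = C and n = n] C[OF t]
    by (simp add: pos_le_divide_eq del: of_nat_Suc)
  then show ?thesis using that by blast
qed

lemma fourier_coeff_time_derivative:
  assumes t: "t \<in> {0..b}"
  shows "((\<lambda>s. fourier_coeff (D j k s) n) has_vector_derivative fourier_coeff (D (Suc j) k t) n)
           (at t within {0..b})"
proof -
  let ?f = "\<lambda>j s \<theta>. complex_of_real (D j k s \<theta>) * echar (- n) \<theta>"
  have "((\<lambda>s. integral (cbox 0 1) (?f j s)) has_vector_derivative integral (cbox 0 1) (?f (Suc j) t))
           (at t within {0..b})"
  proof (rule leibniz_rule_vector_derivative)
    show "((\<lambda>s. ?f j s \<theta>) has_vector_derivative ?f (Suc j) s \<theta>) (at s within {0..b})" if "s \<in> {0..b}" for s \<theta>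
      by (intro has_vector_derivative_mult_left has_vector_derivative_of_real dt that)
    show "?f j s integrable_on cbox 0 1" if "s \<in> {0..b}" for s
      unfolding cbox_interval
      by (intro ccoeff_integrable continuous_intros smooth_periodic_continuous[OF smooth_periodic_slice[OF that]])
    have "continuous_on ({0..b} \<times> cbox 0 1) (\<lambda>x. complex_of_real (case x of (s, \<theta>) \<Rightarrow> D (Suc j) k s \<theta>) * echar (- n) (snd x))"
      by (intro continuous_intros continuous_on_subset[OF cont] continuous_on_compose2[OF continuous_on_echar[of UNIV]]) auto
    then show "continuous_on ({0..b} \<times> cbox 0 1) (\<lambda>(s, \<theta>). ?f (Suc j) s \<theta>)"
      by (simp add: case_prod_unfold)
  qed (use t in auto)
  then show ?thesis by (simp add: fourier_coeff_eq_ccoeff ccoeff_def)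
qed

text \<open>The Hilbert transform commutes with the time derivative because the differentiated Fourier
  series converges uniformly in time.\<close>

lemma hilbert_time_derivative:
  assumes t: "t \<in> {0..b}"
  shows "((\<lambda>s. hilbert (D j k s) \<theta>) has_real_derivative hilbert (D (Suc j) k t) \<theta>) (at t within {0..b})"
proof -
  let ?c = "\<lambda>j n s. fourier_coeff (D j k s) (int (Suc n))"
  let ?f = "\<lambda>j n s. 2 * Im (?c j n s * echar (int (Suc n)) \<theta>)"
  have sums: "(\<lambda>n. ?f j n s) sums hilbert (D j k s) \<theta>" if "s \<in> {0..b}" for j s
    unfolding hilbert_eq_Im_analytic_part[OF summable_fourier_coeff[OF smooth_periodic_slice[OF that]]]
      analytic_part_def pos_series_def
    by (intro sums_mult sums_Im summable_sums summable_pos_series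
        summable_fourier_coeff[OF smooth_periodic_slice[OF that]])
  obtain C where C: "\<And>t n. t \<in> {0..b} \<Longrightarrow> norm (?c (Suc j) n t) \<le> C / real (Suc n) ^ 2"
    using fourier_coeff_uniform_decay by blast
  have "\<exists>g. \<forall>s\<in>{0..b}. (\<lambda>n. ?f j n s) sums g s
          \<and> (g has_real_derivative hilbert (D (Suc j) k s) \<theta>) (at s within {0..b})"
  proof (rule has_field_derivative_series)
    show "(?f j n has_real_derivative ?f (Suc j) n s) (at s within {0..b})" if "s \<in> {0..b}" for n s
    proof -
      have "((\<lambda>s. ?c j n s * echar (int (Suc n)) \<theta>) has_vector_derivative
              ?c (Suc j) n s * echar (int (Suc n)) \<theta>) (at s within {0..b})"
        by (intro has_vector_derivative_mult_left fourier_coeff_time_derivative that)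
      from bounded_linear.has_vector_derivative[OF bounded_linear_Im this]
      have "((\<lambda>s. Im (?c j n s * echar (int (Suc n)) \<theta>)) has_real_derivative
               Im (?c (Suc j) n s * echar (int (Suc n)) \<theta>)) (at s within {0..b})"
        by (simp add: has_real_derivative_iff_has_vector_derivative)
      from DERIV_cmult[OF this, of 2] show ?thesis by simp
    qed
    have "uniform_limit {0..b} (\<lambda>n s. \<Sum>i<n. ?f (Suc j) i s) (\<lambda>s. \<Sum>n. ?f (Suc j) n s) sequentially"
    proof (rule Weierstrass_m_test)
      show "norm (?f (Suc j) n s) \<le> 2 * (C / real (Suc n) ^ 2)" if "s \<in> {0..b}" for n s
        using abs_Im_le_cmod[of "?c (Suc j) n s * echar (int (Suc n)) \<theta>"] C[OF that, of n]
        by (simp add: norm_mult)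
      show "summable (\<lambda>n. 2 * (C / real (Suc n) ^ 2))"
        by (intro summable_mult summable_inverse_squares)
    qed
    then show "uniform_limit {0..b} (\<lambda>n s. \<Sum>i<n. ?f (Suc j) i s) (\<lambda>s. hilbert (D (Suc j) k s) \<theta>) sequentially"
      by (rule uniform_limit_cong'[THEN iffD1, rotated 2]) (use sums_unique[OF sums] in auto)
    show "summable (\<lambda>n. ?f j n t)" using sums[OF t] by (rule sums_summable)
  qed (use t in auto)
  then obtain g where g: "\<And>s. s \<in> {0..b} \<Longrightarrow> (\<lambda>n. ?f j n s) sums g s"
    and dg: "\<And>s. s \<in> {0..b} \<Longrightarrow> (g has_real_derivative hilbert (D (Suc j) k s) \<theta>) (at s within {0..b})" by blast
  have "g s = hilbert (D j k s) \<theta>" if "s \<in> {0..b}" for s using sums_unique2[OF g[OF that] sums[OF that]] .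
  then show ?thesis
    by (intro has_field_derivative_transform_within[OF dg[OF t] zero_less_one t])
qed

lemma hilbert_continuous: "continuous_on ({0..b} \<times> UNIV) (\<lambda>(t, \<theta>). hilbert (D j k t) \<theta>)"
proof -
  let ?c = "\<lambda>n s. fourier_coeff (D j k s) (int (Suc n))"
  let ?f = "\<lambda>n x. 2 * Im (?c n (fst x) * echar (int (Suc n)) (snd x))"
  obtain C where C: "\<And>t n. t \<in> {0..b} \<Longrightarrow> norm (?c n t) \<le> C / real (Suc n) ^ 2"
    using fourier_coeff_uniform_decay by blast
  have lim: "uniform_limit ({0..b} \<times> UNIV) (\<lambda>n x. \<Sum>i<n. ?f i x) (\<lambda>x. \<Sum>n. ?f n x) sequentially"
  proof (rule Weierstrass_m_test)
    show "norm (?f n x) \<le> 2 * (C / real (Suc n) ^ 2)" if "x \<in> {0..b} \<times> UNIV" for n x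
    proof -
      have "fst x \<in> {0..b}" using that by auto
      from abs_Im_le_cmod[of "?c n (fst x) * echar (int (Suc n)) (snd x)"] C[OF this, of n]
      show ?thesis by (simp add: norm_mult)
    qed
    show "summable (\<lambda>n. 2 * (C / real (Suc n) ^ 2))"
      by (intro summable_mult summable_inverse_squares)
  qed
  have cc: "continuous_on {0..b} (?c n)" for n
    by (rule continuous_on_vector_derivative) (rule fourier_coeff_time_derivative)
  have "continuous_on ({0..b} \<times> UNIV) (\<lambda>x. \<Sum>n. ?f n x)"
  proof (rule uniform_limit_theorem[OF _ lim])
    have "continuous_on ({0..b} \<times> UNIV) (?f i)" for i
      by (intro continuous_intros continuous_on_compose2[OF cc] continuous_on_compose2[OF continuous_on_echar[of UNIV]]) auto
    then show "\<forall>\<^sub>F n in sequentially. continuous_on ({0..b} \<times> UNIV) (\<lambda>x. \<Sum>i<n. ?f i x)"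
      by (intro always_eventually allI continuous_on_sum)
  qed simp
  moreover have "(\<Sum>n. ?f n x) = (case x of (t, \<theta>) \<Rightarrow> hilbert (D j k t) \<theta>)" if "x \<in> {0..b} \<times> UNIV" for x
  proof -
    have t: "fst x \<in> {0..b}" using that by auto
    have "(\<lambda>n. ?f n x) sums hilbert (D j k (fst x)) (snd x)"
      unfolding hilbert_eq_Im_analytic_part[OF summable_fourier_coeff[OF smooth_periodic_slice[OF t]]]
        analytic_part_def pos_series_def
      by (intro sums_mult sums_Im summable_sums summable_pos_series
          summable_fourier_coeff[OF smooth_periodic_slice[OF t]])
    then show ?thesis by (simp add: case_prod_unfold sums_iff)
  qed
  ultimately show ?thesis by (simp cong: continuous_on_cong)
qed

end

text \<open>Continuity of one of the two partial derivatives, here the one in space, is enough for total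
  differentiability.\<close>

lemma chain_rule_along_curve:
  fixes f :: "real \<Rightarrow> real \<Rightarrow> real"
  assumes t: "t \<in> I"
    and ft: "((\<lambda>s. f s (\<gamma> t)) has_real_derivative ft) (at t within I)"
    and fx: "\<And>s x. s \<in> I \<Longrightarrow> (f s has_real_derivative fx s x) (at x)"
    and fx_cont: "continuous_on (I \<times> UNIV) (\<lambda>(s, x). fx s x)"
    and \<gamma>: "(\<gamma> has_real_derivative v) (at t within I)"
  shows "((\<lambda>s. f s (\<gamma> s)) has_real_derivative ft + fx t (\<gamma> t) * v) (at t within I)"
proof -
  have "((\<lambda>(s, x). f s x) has_derivative (\<lambda>(ts, tx). ft * ts + blinfun_mult_right (fx t (\<gamma> t)) tx))
          (at (t, \<gamma> t) within I \<times> UNIV)"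
  proof (rule has_derivative_partialsI[where fy = "\<lambda>s x. blinfun_mult_right (fx s x)"])
    show "((\<lambda>s. f s (\<gamma> t)) has_derivative (*) ft) (at t within I)"
      using ft by (simp add: has_field_derivative_def)
    show "(f s has_derivative blinfun_apply (blinfun_mult_right (fx s x))) (at x within UNIV)" if "s \<in> I" for s x
      using fx[OF that, of x] by (simp add: has_field_derivative_def)
    have "continuous_on (I \<times> UNIV) (\<lambda>z. blinfun_mult_right ((\<lambda>(s, x). fx s x) z))"
      by (intro bounded_linear.continuous_on[OF bounded_linear_blinfun_mult_right] fx_cont)
    then show "continuous (at (t, \<gamma> t) within I \<times> UNIV) (\<lambda>(s, x). blinfun_mult_right (fx s x))"
      using t by (simp add: continuous_on_eq_continuous_within case_prod_unfold)
  qed auto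
  moreover have "((\<lambda>s. (s, \<gamma> s)) has_derivative (\<lambda>h. (h, v * h))) (at t within I)"
    using \<gamma> unfolding has_field_derivative_def by (intro has_derivative_Pair has_derivative_ident)
  ultimately have "((\<lambda>(s, x). f s x) \<circ> (\<lambda>s. (s, \<gamma> s)) has_derivative
      (\<lambda>(ts, tx). ft * ts + blinfun_mult_right (fx t (\<gamma> t)) tx) \<circ> (\<lambda>h. (h, v * h))) (at t within I)"
    by (intro diff_chain_within) (auto elim: has_derivative_subset)
  then show ?thesis
    unfolding has_field_derivative_def o_def prod.case
    by (rule has_derivative_eq_rhs) (simp add: fun_eq_iff algebra_simps)
qed

section \<open>The flow and its Jacobian\<close>

locale smooth_flow = smooth_field +
  fixes \<eta> :: "real \<Rightarrow> real \<Rightarrow> real"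
  assumes flow_0: "\<eta> 0 \<theta> = \<theta>"
    and flow: "t \<in> {0..b} \<Longrightarrow> ((\<lambda>s. \<eta> s \<theta>) has_real_derivative D 0 0 t (\<eta> t \<theta>)) (at t within {0..b})"
begin

lemma flow_continuous: "continuous_on {0..b} (\<lambda>s. \<eta> s \<theta>)"
  by (rule DERIV_continuous_on) (rule flow)

lemma along_flow_continuous: "continuous_on {0..b} (\<lambda>s. D j k s (\<eta> s \<theta>))"
proof -
  have "continuous_on {0..b} (\<lambda>s. (\<lambda>(t, \<theta>). D j k t \<theta>) (s, \<eta> s \<theta>))"
    by (rule continuous_on_compose2[OF cont]) (auto intro!: continuous_intros flow_continuous)
  then show ?thesis by simp
qed

lemma along_flow_derivative:
  assumes "t \<in> {0..b}"
  shows "((\<lambda>s. D j k s (\<eta> s \<theta>)) has_real_derivative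
           D (Suc j) k t (\<eta> t \<theta>) + D j (Suc k) t (\<eta> t \<theta>) * D 0 0 t (\<eta> t \<theta>)) (at t within {0..b})"
  using assms by (intro chain_rule_along_curve dt dx cont flow)

text \<open>The logarithm of \<open>\<eta>\<^sub>\<theta>\<close>, obtained by integrating the equation of first variation
  \<open>\<partial>\<^sub>t \<eta>\<^sub>\<theta> = u\<^sub>\<theta> \<eta>\<^sub>\<theta>\<close>; that \<open>\<eta>\<close> is differentiable in space at all is proved below.\<close>

definition log_jacobian :: "real \<Rightarrow> real \<Rightarrow> real" where
  "log_jacobian t \<theta> = integral {0..t} (\<lambda>s. D 0 1 s (\<eta> s \<theta>))"

lemma log_jacobian_0 [simp]: "log_jacobian 0 \<theta> = 0"
  by (simp add: log_jacobian_def)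

lemma log_jacobian_derivative:
  assumes "t \<in> {0..b}"
  shows "((\<lambda>t. log_jacobian t \<theta>) has_real_derivative D 0 1 t (\<eta> t \<theta>)) (at t within {0..b})"
  unfolding log_jacobian_def by (rule integral_has_real_derivative[OF along_flow_continuous assms])

text \<open>Gronwall's inequality, for the square of the distance in order to avoid absolute values.\<close>

lemma flow_separation_le:
  assumes L: "\<And>t \<theta>. t \<in> {0..b} \<Longrightarrow> \<bar>D 0 1 t \<theta>\<bar> \<le> L" and t: "t \<in> {0..b}"
  shows "(\<eta> t x - \<eta> t y)\<^sup>2 \<le> (x - y)\<^sup>2 * exp (2 * L * b)"
proof -
  define \<delta> where "\<delta> = (\<lambda>s. \<eta> s x - \<eta> s y)"
  define f where "f = (\<lambda>s. (\<delta> s)\<^sup>2 * exp (- 2 * L * s))"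
  define f' where "f' = (\<lambda>s. (2 * \<delta> s * (D 0 0 s (\<eta> s x) - D 0 0 s (\<eta> s y)) - 2 * L * (\<delta> s)\<^sup>2) * exp (- 2 * L * s))"
  have df: "(f has_real_derivative f' s) (at s within {0..b})" if "s \<in> {0..b}" for s
    unfolding f_def f'_def \<delta>_def
    by (auto intro!: derivative_eq_intros flow[OF that] simp: algebra_simps)
  have neg: "f' s \<le> 0" if s: "s \<in> {0..b}" for s
  proof -
    have "\<bar>D 0 0 s (\<eta> s x) - D 0 0 s (\<eta> s y)\<bar> \<le> L * \<bar>\<delta> s\<bar>"
      using field_differentiable_bound[of UNIV "D 0 0 s" "D 0 1 s" L "\<eta> s x" "\<eta> s y"]
        dx[OF s, of 0 0] L[OF s] by (simp add: \<delta>_def)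
    then have "\<bar>\<delta> s\<bar> * \<bar>D 0 0 s (\<eta> s x) - D 0 0 s (\<eta> s y)\<bar> \<le> \<bar>\<delta> s\<bar> * (L * \<bar>\<delta> s\<bar>)"
      by (rule mult_left_mono) simp
    also have "\<dots> = L * (\<delta> s)\<^sup>2" by (simp add: power2_eq_square mult_ac flip: abs_mult)
    finally have "\<delta> s * (D 0 0 s (\<eta> s x) - D 0 0 s (\<eta> s y)) \<le> L * (\<delta> s)\<^sup>2"
      by (simp only: flip: abs_mult)
    then show ?thesis unfolding f'_def by (intro mult_nonpos_nonneg) auto
  qed
  have "f t \<le> f 0"
  proof (rule DERIV_nonpos_imp_decreasing_open[where f = f and a = 0 and b = t])
    show "0 \<le> t" using t by simp
    have "continuous_on {0..b} f" by (rule DERIV_continuous_on) (rule df)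
    then show "continuous_on {0..t} f" by (rule continuous_on_subset) (use t in auto)
    fix s assume s: "0 < s" "s < t"
    then have "at s within {0..b} = at s" using t by (intro at_within_interior) auto
    then show "\<exists>y. (f has_real_derivative y) (at s) \<and> y \<le> 0"
      using df[of s] neg[of s] s t by auto
  qed
  then have "(\<delta> t)\<^sup>2 * exp (- 2 * L * t) \<le> (x - y)\<^sup>2"
    by (simp add: f_def \<delta>_def flow_0)
  then have "(\<delta> t)\<^sup>2 * exp (- 2 * L * t) * exp (2 * L * t) \<le> (x - y)\<^sup>2 * exp (2 * L * t)"
    by (rule mult_right_mono) simp
  then have "(\<delta> t)\<^sup>2 \<le> (x - y)\<^sup>2 * exp (2 * L * t)" by (simp add: mult.assoc flip: exp_add)
  also have "\<dots> \<le> (x - y)\<^sup>2 * exp (2 * L * b)"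
  proof -
    have "L \<ge> 0" using L[OF t, of 0] by linarith
    then show ?thesis using t by (intro mult_left_mono) (auto intro: mult_left_mono)
  qed
  finally show ?thesis by (simp add: \<delta>_def)
qed

text \<open>Let \<open>\<delta>\<close> be the distance of the trajectories from \<open>\<theta> + h\<close> and \<open>\<theta>\<close>. It solves the equation
  of first variation up to an error quadratic in \<open>\<delta>\<close>, by Taylor's theorem, hence quadratic in \<open>h\<close>,
  by the Gronwall bound. Therefore \<open>\<delta> exp (- log_jacobian)\<close> stays within \<open>O(h^2)\<close> of its initial
  value \<open>h\<close>.\<close>

lemma flow_has_jacobian:
  assumes t: "t \<in> {0..b}"
  shows "(\<eta> t has_real_derivative exp (log_jacobian t \<theta>)) (at \<theta>)"
proof -
  obtain L where L: "\<And>t \<theta>. t \<in> {0..b} \<Longrightarrow> \<bar>D 0 1 t \<theta>\<bar> \<le> L" using bounded_field by blast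
  obtain C where C0: "C \<ge> 0" and C: "\<And>t \<theta>. t \<in> {0..b} \<Longrightarrow> \<bar>D 0 2 t \<theta>\<bar> \<le> C"
    using bounded_field[of 0 2] by blast
  have L0: "L \<ge> 0" using L[OF t, of 0] by linarith
  have A_bound: "\<bar>log_jacobian s \<theta>\<bar> \<le> L * b" if s: "s \<in> {0..b}" for s
  proof -
    have "norm (log_jacobian s \<theta> - log_jacobian 0 \<theta>) \<le> L * norm (s - 0)"
    proof (rule field_differentiable_bound)
      show "((\<lambda>t. log_jacobian t \<theta>) has_real_derivative D 0 1 z (\<eta> z \<theta>)) (at z within {0..b})"
        if "z \<in> {0..b}" for z by (rule log_jacobian_derivative[OF that])
    qed (use s L in auto)
    also have "\<dots> \<le> L * b" using s L0 by (auto intro: mult_left_mono)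
    finally show ?thesis by simp
  qed
  have taylor: "\<bar>D 0 0 s x - D 0 0 s y - D 0 1 s y * (x - y)\<bar> \<le> C * (x - y)\<^sup>2"
    if s: "s \<in> {0..b}" for s x y
  proof -
    have "norm ((\<lambda>z. D 0 0 s z - D 0 1 s y * z) x - (\<lambda>z. D 0 0 s z - D 0 1 s y * z) y) \<le> (C * \<bar>x - y\<bar>) * norm (x - y)"
    proof (rule field_differentiable_bound[where S = "closed_segment x y" and f' = "\<lambda>z. D 0 1 s z - D 0 1 s y"])
      show "((\<lambda>z. D 0 0 s z - D 0 1 s y * z) has_real_derivative D 0 1 s z - D 0 1 s y) (at z within closed_segment x y)" for z
        using has_field_derivative_at_within[OF dx[OF s, of 0 0 z]] by (auto intro!: derivative_eq_intros)
      show "norm (D 0 1 s z - D 0 1 s y) \<le> C * \<bar>x - y\<bar>" if z: "z \<in> closed_segment x y" for z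
      proof -
        have "norm (D 0 1 s z - D 0 1 s y) \<le> C * norm (z - y)"
          using dx[OF s, of 0 1] C[OF s]
          by (intro field_differentiable_bound[of UNIV "D 0 1 s" "D 0 2 s"]) (auto simp: numeral_2_eq_2)
        also have "\<dots> \<le> C * \<bar>x - y\<bar>"
          using segment_bound(2)[OF z] C0 by (intro mult_left_mono) auto
        finally show ?thesis .
      qed
    qed auto
    then show ?thesis by (simp add: power2_eq_square algebra_simps)
  qed
  \<comment> \<open>The factors are the bound on \<open>exp (- log_jacobian)\<close>, the Taylor constant times the Gronwall
    factor, the length of the time interval, and the bound on \<open>exp log_jacobian\<close>.\<close>
  define M where "M = exp (L * b) * (C * exp (2 * L * b)) * b * exp (L * b)"
  have main: "\<bar>\<eta> t (\<theta> + h) - \<eta> t \<theta> - h * exp (log_jacobian t \<theta>)\<bar> \<le> M * h\<^sup>2" for h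
  proof -
    define e where "e = (\<lambda>s. (\<eta> s (\<theta> + h) - \<eta> s \<theta>) * exp (- log_jacobian s \<theta>))"
    define e' where "e' = (\<lambda>s. (D 0 0 s (\<eta> s (\<theta> + h)) - D 0 0 s (\<eta> s \<theta>)
        - D 0 1 s (\<eta> s \<theta>) * (\<eta> s (\<theta> + h) - \<eta> s \<theta>)) * exp (- log_jacobian s \<theta>))"
    have "norm (e t - e 0) \<le> (C * (h\<^sup>2 * exp (2 * L * b)) * exp (L * b)) * norm (t - 0)"
    proof (rule field_differentiable_bound)
      show "(e has_real_derivative e' s) (at s within {0..b})" if s: "s \<in> {0..b}" for s
        unfolding e_def e'_def
        by (auto intro!: derivative_eq_intros flow[OF s] log_jacobian_derivative[OF s] simp: algebra_simps)
      show "norm (e' s) \<le> C * (h\<^sup>2 * exp (2 * L * b)) * exp (L * b)" if s: "s \<in> {0..b}" for s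
      proof -
        have "\<bar>D 0 0 s (\<eta> s (\<theta> + h)) - D 0 0 s (\<eta> s \<theta>) - D 0 1 s (\<eta> s \<theta>) * (\<eta> s (\<theta> + h) - \<eta> s \<theta>)\<bar>
              \<le> C * (\<eta> s (\<theta> + h) - \<eta> s \<theta>)\<^sup>2" by (rule taylor[OF s])
        also have "\<dots> \<le> C * (h\<^sup>2 * exp (2 * L * b))"
          using flow_separation_le[OF L s, of "\<theta> + h" \<theta>] C0 by (intro mult_left_mono) auto
        finally have 1: "\<bar>D 0 0 s (\<eta> s (\<theta> + h)) - D 0 0 s (\<eta> s \<theta>) - D 0 1 s (\<eta> s \<theta>) * (\<eta> s (\<theta> + h) - \<eta> s \<theta>)\<bar>
              \<le> C * (h\<^sup>2 * exp (2 * L * b))" .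
        have 2: "exp (- log_jacobian s \<theta>) \<le> exp (L * b)" using A_bound[OF s] by simp
        show ?thesis unfolding e'_def real_norm_def abs_mult abs_exp_cancel
          by (intro mult_mono 1 2) (use C0 in auto)
      qed
    qed (use t b_pos in auto)
    also have "\<dots> \<le> (C * (h\<^sup>2 * exp (2 * L * b)) * exp (L * b)) * b"
      using t C0 by (intro mult_left_mono) auto
    also have "e 0 = h" by (simp add: e_def flow_0)
    finally have "\<bar>e t - h\<bar> * exp (log_jacobian t \<theta>) \<le> (C * (h\<^sup>2 * exp (2 * L * b)) * exp (L * b)) * b * exp (L * b)"
      using A_bound[OF t] C0 b_pos by (intro mult_mono) auto
    also have "\<dots> = M * h\<^sup>2" by (simp add: M_def mult_ac)
    also have "\<bar>e t - h\<bar> * exp (log_jacobian t \<theta>) = \<bar>(e t - h) * exp (log_jacobian t \<theta>)\<bar>"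
      by (simp add: abs_mult)
    also have "(e t - h) * exp (log_jacobian t \<theta>) = \<eta> t (\<theta> + h) - \<eta> t \<theta> - h * exp (log_jacobian t \<theta>)"
      by (simp add: e_def left_diff_distrib mult.assoc flip: exp_add)
    finally show ?thesis .
  qed
  show ?thesis unfolding DERIV_def LIM_zero_iff[of _ "exp (log_jacobian t \<theta>)", symmetric]
  proof (rule Lim_null_comparison)
    show "\<forall>\<^sub>F h in at 0. norm ((\<eta> t (\<theta> + h) - \<eta> t \<theta>) / h - exp (log_jacobian t \<theta>)) \<le> M * \<bar>h\<bar>"
      unfolding eventually_at_filter
    proof (intro always_eventually allI impI)
      fix h :: real assume "h \<noteq> 0"
      then have "norm ((\<eta> t (\<theta> + h) - \<eta> t \<theta>) / h - exp (log_jacobian t \<theta>))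
          = \<bar>\<eta> t (\<theta> + h) - \<eta> t \<theta> - h * exp (log_jacobian t \<theta>)\<bar> / \<bar>h\<bar>"
        by (simp add: diff_divide_distrib flip: abs_divide)
      also have "\<dots> \<le> M * h\<^sup>2 / \<bar>h\<bar>" by (intro divide_right_mono main) simp
      also have "\<dots> = M * \<bar>h\<bar>" using \<open>h \<noteq> 0\<close> by (simp add: power2_eq_square abs_if)
      finally show "norm ((\<eta> t (\<theta> + h) - \<eta> t \<theta>) / h - exp (log_jacobian t \<theta>)) \<le> M * \<bar>h\<bar>" .
    qed
    show "((\<lambda>h. M * \<bar>h\<bar>) \<longlongrightarrow> 0) (at 0)"
      by (auto intro!: tendsto_eq_intros)
  qed
qed

lemma deriv_flow: "t \<in> {0..b} \<Longrightarrow> deriv (\<eta> t) \<theta> = exp (log_jacobian t \<theta>)"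
  by (rule DERIV_imp_deriv) (rule flow_has_jacobian)

end

section \<open>The solar model\<close>

text \<open>The equation with the derivatives of the momentum written as Hilbert transforms of
  derivatives of \<open>u\<close>.\<close>

locale mCLM_flow = smooth_flow +
  fixes lam :: real
  assumes mCLM: "t \<in> {0..b} \<Longrightarrow>
    hilbert (D 1 1 t) \<theta> + D 0 0 t \<theta> * hilbert (D 0 2 t) \<theta> + lam * D 0 1 t \<theta> * hilbert (D 0 1 t) \<theta> = 0"
begin

abbreviation "strain s \<theta> \<equiv> D 0 1 s (\<eta> s \<theta>)"
abbreviation "momentum s \<theta> \<equiv> hilbert (D 0 1 s) (\<eta> s \<theta>)"
abbreviation "F t \<equiv> force lam (\<lambda>k. D 0 k t) (D 1 1 t)"

lemma momentum_derivative:
  assumes t: "t \<in> {0..b}"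
  shows "((\<lambda>s. momentum s \<theta>) has_real_derivative - lam * strain t \<theta> * momentum t \<theta>) (at t within {0..b})"
proof -
  have "((\<lambda>s. momentum s \<theta>) has_real_derivative
      hilbert (D 1 1 t) (\<eta> t \<theta>) + hilbert (D 0 2 t) (\<eta> t \<theta>) * D 0 0 t (\<eta> t \<theta>)) (at t within {0..b})"
  proof (rule chain_rule_along_curve[where f = "\<lambda>s. hilbert (D 0 1 s)"
        and fx = "\<lambda>s. hilbert (D 0 2 s)" and \<gamma> = "\<lambda>s. \<eta> s \<theta>", OF t])
    show "((\<lambda>s. hilbert (D 0 1 s) (\<eta> t \<theta>)) has_real_derivative hilbert (D 1 1 t) (\<eta> t \<theta>)) (at t within {0..b})"
      using hilbert_time_derivative[OF t, of 0 1] by simp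
    show "(hilbert (D 0 1 s) has_real_derivative hilbert (D 0 2 s) x) (at x)" if "s \<in> {0..b}" for s x
      using hilbert_has_derivative[OF smooth_periodic_slice[OF that], of 0 1] by (simp add: numeral_2_eq_2)
  qed (use hilbert_continuous flow[OF t] in auto)
  then show ?thesis
    by (rule DERIV_cong) (use mCLM[OF t, of "\<eta> t \<theta>"] in \<open>simp add: algebra_simps\<close>)
qed

text \<open>Conservation of \<open>m(t, \<eta>) \<eta>\<^sub>\<theta> powr lam\<close> along trajectories. It makes the angular velocity of the
  solar model equal to \<open>lam / 2\<close> times the momentum, and it shows that momentum cannot vanish
  identically at a later time unless it did so initially.\<close>

lemma momentum_transport:
  assumes t: "t \<in> {0..b}"
  shows "momentum t \<theta> = hilbert (D 0 1 0) \<theta> * exp (- lam * log_jacobian t \<theta>)"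
proof -
  let ?g = "\<lambda>s. momentum s \<theta> * exp (lam * log_jacobian s \<theta>)"
  have "(?g has_real_derivative 0) (at s within {0..b})" if s: "s \<in> {0..b}" for s
  proof -
    have "((\<lambda>s. exp (lam * log_jacobian s \<theta>)) has_real_derivative
            exp (lam * log_jacobian s \<theta>) * (lam * strain s \<theta>)) (at s within {0..b})"
      by (auto intro!: derivative_eq_intros log_jacobian_derivative[OF s])
    from DERIV_mult[OF momentum_derivative[OF s] this] show ?thesis
      by (rule DERIV_cong) (simp add: algebra_simps)
  qed
  then obtain c where "\<And>s. s \<in> {0..b} \<Longrightarrow> ?g s = c"
    using has_field_derivative_zero_constant[of "{0..b}" ?g] by auto
  from this[OF t] this[of 0] have "?g t = ?g 0" using b_pos by simp
  then show ?thesis by (simp add: flow_0 exp_minus field_simps)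
qed

lemma solar_angle_derivative:
  assumes t: "t \<in> {0..b}" and m: "m 0 \<theta> = hilbert (D 0 1 0) \<theta>"
  shows "((\<lambda>s. solar_angle lam m \<eta> s \<theta>) has_real_derivative lam / 2 * momentum t \<theta>) (at t within {0..b})"
proof -
  let ?g = "\<lambda>\<tau>. exp (- lam * log_jacobian \<tau> \<theta>)"
  have "continuous_on {0..b} (\<lambda>t. log_jacobian t \<theta>)"
    by (rule DERIV_continuous_on) (rule log_jacobian_derivative)
  then have "continuous_on {0..b} ?g" by (intro continuous_intros)
  from DERIV_cmult[OF integral_has_real_derivative[OF this t], of "lam * m 0 \<theta> / 2"]
  have "((\<lambda>s. lam * m 0 \<theta> / 2 * integral {0..s} ?g) has_real_derivative lam / 2 * momentum t \<theta>) (at t within {0..b})"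
    unfolding momentum_transport[OF t] m by (simp add: mult_ac)
  moreover have "lam * m 0 \<theta> / 2 * integral {0..s} ?g = solar_angle lam m \<eta> s \<theta>" if "s \<in> {0..b}" for s
  proof -
    have "integral {0..s} ?g = integral {0..s} (\<lambda>\<tau>. 1 / deriv (\<eta> \<tau>) \<theta> powr lam)"
      using that by (intro integral_cong) (simp add: deriv_flow exp_powr_real exp_minus field_simps)
    then show ?thesis by (simp add: solar_angle_def)
  qed
  ultimately show ?thesis
    by (rule has_field_derivative_transform_within[OF _ zero_less_one t])
qed

lemma solar_polar:
  assumes "s \<in> {0..b}"
  shows "solar_x lam m \<eta> s \<theta> = exp (lam / 2 * log_jacobian s \<theta>) * cos (solar_angle lam m \<eta> s \<theta>)"
    and "solar_y lam m \<eta> s \<theta> = exp (lam / 2 * log_jacobian s \<theta>) * sin (solar_angle lam m \<eta> s \<theta>)"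
  using assms by (simp_all add: solar_x_def solar_y_def deriv_flow exp_powr_real mult_ac)

text \<open>Expressing the velocity through \<open>solar_x\<close> and \<open>solar_y\<close> themselves turns the second
  differentiation into an application of the first.\<close>

lemma solar_velocity:
  assumes t: "t \<in> {0..b}" and m: "m 0 \<theta> = hilbert (D 0 1 0) \<theta>"
  shows "((\<lambda>s. solar_x lam m \<eta> s \<theta>) has_real_derivative
            lam / 2 * (strain t \<theta> * solar_x lam m \<eta> t \<theta> - momentum t \<theta> * solar_y lam m \<eta> t \<theta>)) (at t within {0..b})"
    and "((\<lambda>s. solar_y lam m \<eta> s \<theta>) has_real_derivative
            lam / 2 * (strain t \<theta> * solar_y lam m \<eta> t \<theta> + momentum t \<theta> * solar_x lam m \<eta> t \<theta>)) (at t within {0..b})"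
proof -
  let ?\<psi> = "\<lambda>s. solar_angle lam m \<eta> s \<theta>" and ?r = "\<lambda>s. exp (lam / 2 * log_jacobian s \<theta>)"
  have "((\<lambda>s. ?r s * cos (?\<psi> s)) has_real_derivative
       lam / 2 * (strain t \<theta> * (?r t * cos (?\<psi> t)) - momentum t \<theta> * (?r t * sin (?\<psi> t)))) (at t within {0..b})"
    by (auto intro!: derivative_eq_intros log_jacobian_derivative[OF t] solar_angle_derivative[where m = m, OF t m]
        simp: algebra_simps)
  then show "((\<lambda>s. solar_x lam m \<eta> s \<theta>) has_real_derivative
            lam / 2 * (strain t \<theta> * solar_x lam m \<eta> t \<theta> - momentum t \<theta> * solar_y lam m \<eta> t \<theta>)) (at t within {0..b})"
    unfolding solar_polar[OF t]
    by (rule has_field_derivative_transform_within[OF _ zero_less_one t]) (simp add: solar_polar)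
  have "((\<lambda>s. ?r s * sin (?\<psi> s)) has_real_derivative
       lam / 2 * (strain t \<theta> * (?r t * sin (?\<psi> t)) + momentum t \<theta> * (?r t * cos (?\<psi> t)))) (at t within {0..b})"
    by (auto intro!: derivative_eq_intros log_jacobian_derivative[OF t] solar_angle_derivative[where m = m, OF t m]
        simp: algebra_simps)
  then show "((\<lambda>s. solar_y lam m \<eta> s \<theta>) has_real_derivative
            lam / 2 * (strain t \<theta> * solar_y lam m \<eta> t \<theta> + momentum t \<theta> * solar_x lam m \<eta> t \<theta>)) (at t within {0..b})"
    unfolding solar_polar[OF t]
    by (rule has_field_derivative_transform_within[OF _ zero_less_one t]) (simp add: solar_polar)
qed

text \<open>The acceleration is central because the derivative of the momentum cancels against the two
  cross terms of strain and momentum.\<close>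

lemma solar_acceleration:
  assumes t: "t \<in> {0..b}" and m: "m 0 \<theta> = hilbert (D 0 1 0) \<theta>"
  shows "((\<lambda>s. lam / 2 * (strain s \<theta> * solar_x lam m \<eta> s \<theta> - momentum s \<theta> * solar_y lam m \<eta> s \<theta>)) has_real_derivative
            - (lam / 2) * F t (\<eta> t \<theta>) * solar_x lam m \<eta> t \<theta>) (at t within {0..b})"
    and "((\<lambda>s. lam / 2 * (strain s \<theta> * solar_y lam m \<eta> s \<theta> + momentum s \<theta> * solar_x lam m \<eta> s \<theta>)) has_real_derivative
            - (lam / 2) * F t (\<eta> t \<theta>) * solar_y lam m \<eta> t \<theta>) (at t within {0..b})"
proof -
  note d = along_flow_derivative[OF t, of 0 1] momentum_derivative[OF t] solar_velocity[where m = m, OF t m]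
  show "((\<lambda>s. lam / 2 * (strain s \<theta> * solar_x lam m \<eta> s \<theta> - momentum s \<theta> * solar_y lam m \<eta> s \<theta>)) has_real_derivative
            - (lam / 2) * F t (\<eta> t \<theta>) * solar_x lam m \<eta> t \<theta>) (at t within {0..b})"
    by (rule DERIV_cong, rule DERIV_cmult[OF DERIV_diff[OF DERIV_mult[OF d(1) d(3)] DERIV_mult[OF d(2) d(4)]]])
       (simp add: force_def power2_eq_square numeral_2_eq_2 field_simps)
  show "((\<lambda>s. lam / 2 * (strain s \<theta> * solar_y lam m \<eta> s \<theta> + momentum s \<theta> * solar_x lam m \<eta> s \<theta>)) has_real_derivative
            - (lam / 2) * F t (\<eta> t \<theta>) * solar_y lam m \<eta> t \<theta>) (at t within {0..b})"
    by (rule DERIV_cong, rule DERIV_cmult[OF DERIV_add[OF DERIV_mult[OF d(1) d(4)] DERIV_mult[OF d(2) d(3)]]])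
       (simp add: force_def power2_eq_square numeral_2_eq_2 field_simps)
qed

lemma periodic1_force:
  assumes t: "t \<in> {0..b}" shows "periodic1 (F t)"
  using periodic[OF t] periodic1_hilbert[OF smooth_periodic_slice[OF t], of 0 1]
  by (simp add: periodic1_def force_def)

lemma force_nonneg:
  assumes t: "t \<in> {0..b}" shows "F t \<theta> \<ge> 0"
  using force_pos(1)[OF smooth_periodic_slice[OF t] smooth_periodic_slice[OF t] mCLM[OF t]] .

lemma force_zero_imp_constant:
  assumes t: "t \<in> {0..b}" and zero: "F t \<theta> = 0"
  shows "D 0 0 0 constant_on UNIV"
proof (rule hilbert_deriv_eq_0_imp_constant[where d = "\<lambda>k. D 0 k 0"])
  show "smooth_periodic (\<lambda>k. D 0 k 0)" using smooth_periodic_slice[of 0 0] b_pos by simp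
  have "momentum t x = 0" for x
    by (rule force_pos(2)[OF smooth_periodic_slice[OF t] smooth_periodic_slice[OF t] mCLM[OF t] zero])
  then show "hilbert (D 0 1 0) x = 0" for x using momentum_transport[OF t, of x] by simp
qed

end

lemma has_real_derivative_unique_within:
  assumes "a < b" "t \<in> {a..b::real}"
    and "(f has_real_derivative x) (at t within {a..b})" "(f has_real_derivative y) (at t within {a..b})"
  shows "x = y"
  using assms vector_derivative_unique_within_closed_interval[of a b t f x y]
  by (simp add: has_real_derivative_iff_has_vector_derivative cbox_interval)

text \<open>The given smoothness data provide neither periodicity of the derivatives nor the form of the
  derivatives of \<open>m\<close>: both follow from the uniqueness of derivatives, the latter together with the
  differentiation rules for the Hilbert transform.\<close>

lemma mCLM_flow_of_solution:
  fixes D :: "nat \<Rightarrow> nat \<Rightarrow> real \<Rightarrow> real \<Rightarrow> real"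
  assumes b: "0 < b" and sub: "{0..b} \<subseteq> J"
    and sol: "mCLM_solution lam J u m" and fl: "is_flow J u \<eta>"
    and D0: "\<forall>t\<in>J. \<forall>\<theta>. D 0 0 t \<theta> = u t \<theta>"
    and Dcont: "\<forall>j k. continuous_on (J \<times> UNIV) (\<lambda>(t, \<theta>). D j k t \<theta>)"
    and Dder: "\<forall>j k. \<forall>t\<in>J. \<forall>\<theta>.
          ((\<lambda>s. D j k s \<theta>) has_real_derivative D (Suc j) k t \<theta>) (at t within J) \<and>
          (D j k t has_real_derivative D j (Suc k) t \<theta>) (at \<theta>)"
  shows "mCLM_flow b D \<eta> lam"
    and "\<And>t. t \<in> {0..b} \<Longrightarrow> m t = hilbert (D 0 1 t)"
proof -
  have inJ: "t \<in> J" if "t \<in> {0..b}" for t using sub that by auto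
  have dt: "((\<lambda>s. D j k s \<theta>) has_real_derivative D (Suc j) k t \<theta>) (at t within {0..b})" if "t \<in> {0..b}" for j k t \<theta>
    using Dder inJ[OF that] DERIV_subset[OF _ sub] by blast
  have dx: "(D j k t has_real_derivative D j (Suc k) t \<theta>) (at \<theta>)" if "t \<in> {0..b}" for j k t \<theta>
    using Dder inJ[OF that] by blast
  have u_eq: "u t = D 0 0 t" if "t \<in> {0..b}" for t using D0 inJ[OF that] by auto
  have shift_x: "f' (\<theta> + 1) = f' \<theta>"
    if "periodic1 f" "\<And>\<theta>. (f has_real_derivative f' \<theta>) (at \<theta>)" for f f' :: "real \<Rightarrow> real" and \<theta>
  proof -
    have "(f has_real_derivative f' (\<theta> + 1)) (at \<theta>)"
      using that(2)[of "\<theta> + 1"] that(1) by (simp add: DERIV_shift periodic1_def)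
    then show ?thesis using that(2) DERIV_unique by blast
  qed
  have per: "periodic1 (D j k t)" if "t \<in> {0..b}" for j k t
    using that
  proof (induction j arbitrary: k t)
    case 0
    then show ?case
    proof (induction k)
      case 0
      have "periodic1 (u t)" using sol inJ[OF 0] by (simp add: mCLM_solution_def)
      then show ?case unfolding u_eq[OF 0] .
    next
      case (Suc k)
      then show ?case using shift_x[of "D 0 k t" "D 0 (Suc k) t"] dx by (simp add: periodic1_def)
    qed
  next
    case (Suc j)
    have "D (Suc j) k t (\<theta> + 1) = D (Suc j) k t \<theta>" for \<theta>
    proof (rule has_real_derivative_unique_within[OF b Suc.prems])
      show "((\<lambda>s. D j k s (\<theta> + 1)) has_real_derivative D (Suc j) k t (\<theta> + 1)) (at t within {0..b})"
        by (rule dt[OF Suc.prems])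
      show "((\<lambda>s. D j k s (\<theta> + 1)) has_real_derivative D (Suc j) k t \<theta>) (at t within {0..b})"
        by (rule has_field_derivative_transform_within[OF dt[OF Suc.prems] zero_less_one Suc.prems])
          (use Suc.IH in \<open>simp add: periodic1_def\<close>)
    qed
    then show ?case by (simp add: periodic1_def)
  qed
  interpret sf: smooth_field b D
  proof
    show "continuous_on ({0..b} \<times> UNIV) (\<lambda>(t, \<theta>). D j k t \<theta>)" for j k
      by (rule continuous_on_subset[OF Dcont[rule_format]]) (use sub in auto)
  qed (use b per dt dx in auto)
  have ux: "deriv (u t) = D 0 1 t" if "t \<in> {0..b}" for t
    using dx[OF that, of 0 0] u_eq[OF that] by (auto intro!: ext DERIV_imp_deriv)
  show m_eq: "m t = hilbert (D 0 1 t)" if "t \<in> {0..b}" for t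
    using sol inJ[OF that] ux[OF that] by (auto simp: mCLM_solution_def)
  show "mCLM_flow b D \<eta> lam"
  proof
    show "\<eta> 0 \<theta> = \<theta>" for \<theta> using fl by (simp add: is_flow_def)
    show "((\<lambda>s. \<eta> s \<theta>) has_real_derivative D 0 0 t (\<eta> t \<theta>)) (at t within {0..b})" if "t \<in> {0..b}" for t \<theta>
    proof -
      have "((\<lambda>s. \<eta> s \<theta>) has_real_derivative u t (\<eta> t \<theta>)) (at t within J)"
        using fl inJ[OF that] by (simp add: is_flow_def)
      then show ?thesis unfolding u_eq[OF that] by (rule DERIV_subset[OF _ sub])
    qed
    fix t \<theta> assume t: "t \<in> {0..b}"
    obtain mt mx where mt: "((\<lambda>s. m s \<theta>) has_real_derivative mt) (at t within J)"
      and mx: "(m t has_real_derivative mx) (at \<theta>)"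
      and eq: "mt + u t \<theta> * mx + lam * deriv (u t) \<theta> * m t \<theta> = 0"
      using sol inJ[OF t] unfolding mCLM_solution_def by blast
    have "mt = hilbert (D 1 1 t) \<theta>"
    proof (rule has_real_derivative_unique_within[OF b t])
      show "((\<lambda>s. m s \<theta>) has_real_derivative mt) (at t within {0..b})" by (rule DERIV_subset[OF mt sub])
      show "((\<lambda>s. m s \<theta>) has_real_derivative hilbert (D 1 1 t) \<theta>) (at t within {0..b})"
        using sf.hilbert_time_derivative[OF t, of 0 1 \<theta>] unfolding One_nat_def
        by (rule has_field_derivative_transform_within[OF _ zero_less_one t]) (simp add: m_eq)
    qed
    moreover have "mx = hilbert (D 0 2 t) \<theta>"
      using hilbert_has_derivative[OF sf.smooth_periodic_slice[OF t], of 0 1 \<theta>] mx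
      by (auto simp: m_eq[OF t] numeral_2_eq_2 intro: DERIV_unique)
    ultimately show "hilbert (D 1 1 t) \<theta> + D 0 0 t \<theta> * hilbert (D 0 2 t) \<theta> + lam * D 0 1 t \<theta> * hilbert (D 0 1 t) \<theta> = 0"
      using eq by (simp add: u_eq[OF t] ux[OF t, unfolded u_eq[OF t]] m_eq[OF t])
  qed
qed

theorem proposition20:
  fixes lam :: real and T :: ereal and J :: "real set"
    and u m \<eta> :: "real \<Rightarrow> real \<Rightarrow> real"
  assumes "0 < T" and "J = time_interval T"
    and "mCLM_solution lam J u m"
    and "is_flow J u \<eta>"
  shows "\<exists>F :: real \<Rightarrow> real \<Rightarrow> real.
      (\<forall>t\<in>J. periodic1 (F t)) \<and>
      (\<forall>t\<in>J. \<forall>\<theta>.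
         has_second_derivative_within (\<lambda>s. solar_x lam m \<eta> s \<theta>)
           (- (lam / 2) * F t (\<eta> t \<theta>) * solar_x lam m \<eta> t \<theta>) t J \<and>
         has_second_derivative_within (\<lambda>s. solar_y lam m \<eta> s \<theta>)
           (- (lam / 2) * F t (\<eta> t \<theta>) * solar_y lam m \<eta> t \<theta>) t J) \<and>
      (\<forall>t\<in>J. \<forall>\<theta>. 0 \<le> F t \<theta>) \<and>
      (\<not> u 0 constant_on UNIV \<longrightarrow> (\<forall>t\<in>J. \<forall>\<theta>. 0 < F t \<theta>))"
proof -
  obtain D :: "nat \<Rightarrow> nat \<Rightarrow> real \<Rightarrow> real \<Rightarrow> real" where
    D0: "\<forall>t\<in>J. \<forall>\<theta>. D 0 0 t \<theta> = u t \<theta>"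
    and Dcont: "\<forall>j k. continuous_on (J \<times> UNIV) (\<lambda>(t, \<theta>). D j k t \<theta>)"
    and Dder: "\<forall>j k. \<forall>t\<in>J. \<forall>\<theta>.
          ((\<lambda>s. D j k s \<theta>) has_real_derivative D (Suc j) k t \<theta>) (at t within J) \<and>
          (D j k t has_real_derivative D j (Suc k) t \<theta>) (at \<theta>)"
    using assms(3) unfolding mCLM_solution_def smooth_time_space_def by auto
  note flow_on = mCLM_flow_of_solution[OF _ _ assms(3,4) D0 Dcont Dder]
  have bound: "\<exists>b. 0 < b \<and> t < b \<and> t \<in> {0..b} \<and> {0..b} \<subseteq> J \<and> at t within J = at t within {0..b}"
    if t: "t \<in> J" for t
  proof -
    have "ereal t < T" "0 \<le> t" using t assms(2) by (auto simp: time_interval_def)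
    then obtain b where b: "t < b" "ereal b < T" using ereal_dense2[of "ereal t" T] by auto
    have sub: "{0..b} \<subseteq> J"
    proof
      fix s assume "s \<in> {0..b}"
      then have "0 \<le> s" "ereal s \<le> ereal b" by auto
      with b(2) have "0 \<le> s" "ereal s < T" by (auto simp del: ereal_less_eq intro: le_less_trans)
      then show "s \<in> J" using assms(2) by (simp add: time_interval_def)
    qed
    have "at t within J = at t within {0..b}"
    proof (rule at_within_nhd[where S = "{..<b}"])
      have "J \<inter> {..<b} \<subseteq> {0..b}" using assms(2) by (auto simp: time_interval_def)
      then show "J \<inter> {..<b} - {t} = {0..b} \<inter> {..<b} - {t}" using sub by auto
    qed (use b in auto)
    then show ?thesis using b \<open>0 \<le> t\<close> sub by (intro exI[of _ b]) auto
  qed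
  have "0 \<in> J" using assms(1,2) by (simp add: time_interval_def zero_ereal_def)
  then have u0: "D 0 0 0 = u 0" using D0 by auto
  have m0: "m 0 \<theta> = hilbert (D 0 1 0) \<theta>" for \<theta>
    using bound[OF \<open>0 \<in> J\<close>] flow_on(2)[of _ 0] by auto
  define F where "F = (\<lambda>t. force lam (\<lambda>k. D 0 k t) (D 1 1 t))"
  define vx where "vx = (\<lambda>\<theta> s. lam / 2 * (D 0 1 s (\<eta> s \<theta>) * solar_x lam m \<eta> s \<theta>
      - hilbert (D 0 1 s) (\<eta> s \<theta>) * solar_y lam m \<eta> s \<theta>))"
  define vy where "vy = (\<lambda>\<theta> s. lam / 2 * (D 0 1 s (\<eta> s \<theta>) * solar_y lam m \<eta> s \<theta>
      + hilbert (D 0 1 s) (\<eta> s \<theta>) * solar_x lam m \<eta> s \<theta>))"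
  have facts: "periodic1 (F t)" "F t \<theta> \<ge> 0" "F t \<theta> = 0 \<Longrightarrow> u 0 constant_on UNIV"
    "((\<lambda>s. solar_x lam m \<eta> s \<theta>) has_real_derivative vx \<theta> t) (at t within J)"
    "((\<lambda>s. solar_y lam m \<eta> s \<theta>) has_real_derivative vy \<theta> t) (at t within J)"
    "(vx \<theta> has_real_derivative - (lam / 2) * F t (\<eta> t \<theta>) * solar_x lam m \<eta> t \<theta>) (at t within J)"
    "(vy \<theta> has_real_derivative - (lam / 2) * F t (\<eta> t \<theta>) * solar_y lam m \<eta> t \<theta>) (at t within J)"
    if t: "t \<in> J" for t \<theta>
  proof -
    obtain b where b: "0 < b" "t \<in> {0..b}" "{0..b} \<subseteq> J" and at: "at t within J = at t within {0..b}"
      using bound[OF t] by blast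
    interpret mCLM_flow b D \<eta> lam by (rule flow_on(1)[OF b(1,3)])
    show "periodic1 (F t)" "F t \<theta> \<ge> 0" "F t \<theta> = 0 \<Longrightarrow> u 0 constant_on UNIV"
      "((\<lambda>s. solar_x lam m \<eta> s \<theta>) has_real_derivative vx \<theta> t) (at t within J)"
      "((\<lambda>s. solar_y lam m \<eta> s \<theta>) has_real_derivative vy \<theta> t) (at t within J)"
      "(vx \<theta> has_real_derivative - (lam / 2) * F t (\<eta> t \<theta>) * solar_x lam m \<eta> t \<theta>) (at t within J)"
      "(vy \<theta> has_real_derivative - (lam / 2) * F t (\<eta> t \<theta>) * solar_y lam m \<eta> t \<theta>) (at t within J)"
      unfolding F_def vx_def vy_def at u0[symmetric]
      by (fact periodic1_force[OF b(2)] force_nonneg[OF b(2)] force_zero_imp_constant[OF b(2)]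
          solar_velocity[where m = m, OF b(2) m0] solar_acceleration[where m = m, OF b(2) m0])+
  qed
  have "\<forall>t\<in>J. \<forall>\<theta>.
         has_second_derivative_within (\<lambda>s. solar_x lam m \<eta> s \<theta>)
           (- (lam / 2) * F t (\<eta> t \<theta>) * solar_x lam m \<eta> t \<theta>) t J \<and>
         has_second_derivative_within (\<lambda>s. solar_y lam m \<eta> s \<theta>)
           (- (lam / 2) * F t (\<eta> t \<theta>) * solar_y lam m \<eta> t \<theta>) t J"
    unfolding has_second_derivative_within_def using facts(4-7) by blast
  moreover have "\<forall>t\<in>J. \<forall>\<theta>. 0 < F t \<theta>" if "\<not> u 0 constant_on UNIV"
    using facts(2,3) that by (metis order_le_less)
  ultimately show ?thesis using facts(1,2) by blast
qed

end
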